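(* Let $K$ be a field of characteristic $0$, $H$ a Hopf algebra over $K$, $(A,H,\pi,\sigma)$ a splitting datum, $(R,\xi)$ the associated pre-bialgebra with cocycle in ${}_H^H\mathcal{YD}$, and $\gamma\in Z_H^2(A,K)$. Let $\gamma_R=\gamma|_{R\otimes R}$ and $\xi_{\gamma_R}=u_H\gamma_R*\xi*(H\otimes\gamma_R^{-1})\rho_{R\otimes R}$. Then $(R^{\gamma_R},\xi_{\gamma_R})$ is exactly the pre-bialgebra with cocycle associated to the splitting datum $(A^\gamma,H,\pi,\sigma)$.
   Context: Yetter-Drinfeld conventions. ${}_H^H\mathcal{YD}$ is the category of left-left Yetter-Drinfeld modules over $H$: left $H$-modules and left $H$-comodules ($\rho(v)=v_{\langle -1\rangle}\otimes v_{\langle 0\rangle}$) with $\rho(hv)=h_{(1)}v_{\langle -1\rangle}S(h_{(3)})\otimes h_{(2)}v_{\langle 0\rangle}$. Tensor products carry the diagonal action and codiagonal coaction ($\rho_{R\otimes R}(r\otimes s)=r_{\langle-1\rangle}s_{\langle-1\rangle}\otimes r_{\langle0\rangle}\otimes s_{\langle0\rangle}$). For a coalgebra $R$ in ${}_H^H\mathcal{YD}$ write $\Delta_R(x)=x^{(1)}\otimes x^{(2)}$; $R\otimes R$ is a coalgebra in ${}_H^H\mathcal{YD}$ with counit $\varepsilon_R\otimes\varepsilon_R$ and $\Delta_{R\otimes R}(x\otimes y)=(x^{(1)}\otimes x^{(2)}_{\langle -1\rangle}y^{(1)})\otimes(x^{(2)}_{\langle 0\rangle}\otimes y^{(2)})$.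 Convolution $*$ and convolution inverses of maps on $R\otimes R$ are taken with respect to $\Delta_{R\otimes R}$. Splitting data. A splitting datum $(A,H,\pi,\sigma)$ consists of a bialgebra $A$, a bialgebra homomorphism $\sigma:H\to A$ and a coalgebra homomorphism $\pi:A\to H$ with $\pi\sigma=\mathrm{Id}_H$ and $\pi(\sigma(h)x\sigma(h'))=h\pi(x)h'$ for $h,h'\in H$, $x\in A$. The pre-bialgebra with cocycle in ${}_H^H\mathcal{YD}$ associated to it is the pair $(R,\xi)$, where $R=A^{co\pi}=\{a\in A: a_{(1)}\otimes\pi(a_{(2)})=a\otimes 1_H\}$, with action $h\cdot r=\sigma(h_{(1)})r\sigma S(h_{(2)})$, coaction $\rho(r)=\pi(r_{(1)})\otimes r_{(2)}$, comultiplication $\Delta_R(r)=\tau(r_{(1)})\otimes r_{(2)}$, counit $\varepsilon_R=\varepsilon_A|_R$, where $\tau:A\to R$, $\tau(a)=a_{(1)}\sigma S\pi(a_{(2)})$; unit $1_A$, (not necessarily associative) multiplication $m_R(r\otimes s)=\tau(r\cdot_As)$, and cocycle $\xi:R\otimes R\to H$, $\xi(r\otimes s)=\pi(r\cdot_As)$. Cocycles and twists. $Z_H^2(A,K)$ is the set of convolution invertible linear maps $\gamma:A\otimes A\to K$ with $\gamma(y_{(1)}\otimes z_{(1)})\gamma(x\otimes y_{(2)}z_{(2)})=\gamma(x_{(1)}\otimes y_{(1)})\gamma(x_{(2)}y_{(2)}\otimes z)$, $\gamma(x\otimes 1)=\gamma(1\otimes x)=\varepsilon_A(x)$, and $\gamma(\sigma(h)a\otimes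 a'\sigma(h'))=\varepsilon_H(h)\gamma(a\otimes a')\varepsilon_H(h')$. $A^\gamma$ is the bialgebra equal to $A$ as a coalgebra, with the same unit and product $x\cdot_\gamma y=\gamma(x_{(1)}\otimes y_{(1)})x_{(2)}y_{(2)}\gamma^{-1}(x_{(3)}\otimes y_{(3)})$; for $\gamma\in Z^2_H(A,K)$, $(A^\gamma,H,\pi,\sigma)$ is again a splitting datum. $R^{\gamma_R}$ denotes the coalgebra $R$ in ${}_H^H\mathcal{YD}$ with the same unit and multiplication $m_{R^{\gamma_R}}=(\gamma_R\otimes m_R\otimes\gamma_R^{-1})\Delta^2_{R\otimes R}$, where $\Delta^2_{R\otimes R}$ is the twice-iterated comultiplication of $R\otimes R$. *)

theory Defs
  imports Complex_Main "HOL-Library.Poly_Mapping" "HOL-Library.FuncSet"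
begin

section \<open>Tensor products of vector spaces\<close>

text \<open>
  A vector space over \<open>'k\<close> is a type of class \<^class>\<open>ab_group_add\<close> together with a scalar
  multiplication satisfying \<^locale>\<open>vector_space\<close>.  The finitely supported functions
  \<open>'x \<Rightarrow>\<^sub>0 'k\<close> are the free vector space with basis \<open>'x\<close>, and an element of \<open>V \<otimes> W\<close> is a
  coset in the free vector space on \<open>V \<times> W\<close> modulo the bilinearity relations.
\<close>

abbreviation gen :: "'x \<Rightarrow> ('x \<Rightarrow>\<^sub>0 'k::field)" where
  "gen x \<equiv> Poly_Mapping.single x 1"

definition fscale :: "'k::field \<Rightarrow> ('x \<Rightarrow>\<^sub>0 'k) \<Rightarrow> ('x \<Rightarrow>\<^sub>0 'k)" where
  "fscale c p = Poly_Mapping.map ((*) c) p"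

definition lin_ext :: "('k::field \<Rightarrow> 'v \<Rightarrow> 'v::ab_group_add) \<Rightarrow> ('x \<Rightarrow> 'v) \<Rightarrow> ('x \<Rightarrow>\<^sub>0 'k) \<Rightarrow> 'v" where
  "lin_ext s F p = (\<Sum>x\<in>Poly_Mapping.keys p. s (Poly_Mapping.lookup p x) (F x))"

type_synonym ('k, 'a, 'b) tensor = "(('a \<times> 'b) \<Rightarrow>\<^sub>0 'k) set"

definition tensor_null ::
  "('k::field \<Rightarrow> 'a \<Rightarrow> 'a::ab_group_add) \<Rightarrow> ('k \<Rightarrow> 'b \<Rightarrow> 'b::ab_group_add) \<Rightarrow> (('a \<times> 'b) \<Rightarrow>\<^sub>0 'k) set" where
  "tensor_null s1 s2 = module.span fscale
     ({gen (x + x', y) - gen (x, y) - gen (x', y) | x x' y. True}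
    \<union> {gen (x, y + y') - gen (x, y) - gen (x, y') | x y y'. True}
    \<union> {gen (s1 c x, y) - fscale c (gen (x, y)) | c x y. True}
    \<union> {gen (x, s2 c y) - fscale c (gen (x, y)) | c x y. True})"

definition tclass ::
  "('k::field \<Rightarrow> 'a \<Rightarrow> 'a::ab_group_add) \<Rightarrow> ('k \<Rightarrow> 'b \<Rightarrow> 'b::ab_group_add) \<Rightarrow>
   (('a \<times> 'b) \<Rightarrow>\<^sub>0 'k) \<Rightarrow> ('k, 'a, 'b) tensor" where
  "tclass s1 s2 p = {q. q - p \<in> tensor_null s1 s2}"

definition pure_tensor ::
  "('k::field \<Rightarrow> 'a \<Rightarrow> 'a::ab_group_add) \<Rightarrow> ('k \<Rightarrow> 'b \<Rightarrow> 'b::ab_group_add) \<Rightarrow>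
   'a \<Rightarrow> 'b \<Rightarrow> ('k, 'a, 'b) tensor" where
  "pure_tensor s1 s2 x y = tclass s1 s2 (gen (x, y))"

definition tensor_null3 ::
  "('k::field \<Rightarrow> 'a \<Rightarrow> 'a::ab_group_add) \<Rightarrow> ('k \<Rightarrow> 'b \<Rightarrow> 'b::ab_group_add) \<Rightarrow>
   ('k \<Rightarrow> 'c \<Rightarrow> 'c::ab_group_add) \<Rightarrow> (('a \<times> 'b \<times> 'c) \<Rightarrow>\<^sub>0 'k) set" where
  "tensor_null3 s1 s2 s3 = module.span fscale
     ({gen (x + x', y, z) - gen (x, y, z) - gen (x', y, z) | x x' y z. True}
    \<union> {gen (x, y + y', z) - gen (x, y, z) - gen (x, y', z) | x y y' z. True}
    \<union> {gen (x, y, z + z') - gen (x, y, z) - gen (x, y, z') | x y z z'. True}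
    \<union> {gen (s1 c x, y, z) - fscale c (gen (x, y, z)) | c x y z. True}
    \<union> {gen (x, s2 c y, z) - fscale c (gen (x, y, z)) | c x y z. True}
    \<union> {gen (x, y, s3 c z) - fscale c (gen (x, y, z)) | c x y z. True})"

definition tclass3 ::
  "('k::field \<Rightarrow> 'a \<Rightarrow> 'a::ab_group_add) \<Rightarrow> ('k \<Rightarrow> 'b \<Rightarrow> 'b::ab_group_add) \<Rightarrow>
   ('k \<Rightarrow> 'c \<Rightarrow> 'c::ab_group_add) \<Rightarrow> (('a \<times> 'b \<times> 'c) \<Rightarrow>\<^sub>0 'k) \<Rightarrow> (('a \<times> 'b \<times> 'c) \<Rightarrow>\<^sub>0 'k) set" where
  "tclass3 s1 s2 s3 p = {q. q - p \<in> tensor_null3 s1 s2 s3}"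

text \<open>
  Sweedler sums.  For subspaces \<open>V\<close>, \<open>W\<close> and a tensor \<open>t\<close> in the image of \<open>V \<otimes> W\<close> (which is
  identified with \<open>V \<otimes> W\<close> itself, the scalars being a field), \<open>sw_on V W s t F\<close> is the value at
  \<open>t\<close> of the linear map induced by \<open>F\<close>; \<open>s\<close> is the scalar multiplication of the target.  When
  \<open>F\<close> is bilinear on \<open>V \<times> W\<close> this does not depend on the chosen representative.  \<open>F\<close> may also
  take values in a free vector space and be bilinear only modulo some relations; then the class of
  the result modulo these relations is independent of the choice.
\<close>

definition sw_on ::
  "'a set \<Rightarrow> 'b set \<Rightarrow> ('k::field \<Rightarrow> 'v \<Rightarrow> 'v::ab_group_add) \<Rightarrow> ('k, 'a, 'b) tensor \<Rightarrow>
   ('a \<Rightarrow> 'b \<Rightarrow> 'v) \<Rightarrow> 'v" where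
  "sw_on V W s t F =
     lin_ext s (\<lambda>(x, y). F x y) (SOME p. p \<in> t \<and> Poly_Mapping.keys p \<subseteq> V \<times> W)"

abbreviation sw ::
  "('k::field \<Rightarrow> 'v \<Rightarrow> 'v::ab_group_add) \<Rightarrow> ('k, 'a, 'b) tensor \<Rightarrow> ('a \<Rightarrow> 'b \<Rightarrow> 'v) \<Rightarrow> 'v" where
  "sw \<equiv> sw_on UNIV UNIV"

text \<open>The map \<open>f \<otimes> g\<close>; \<open>s1\<close>, \<open>s2\<close> are the scalar multiplications of the two targets.\<close>

definition tmap ::
  "('k::field \<Rightarrow> 'c \<Rightarrow> 'c::ab_group_add) \<Rightarrow> ('k \<Rightarrow> 'd \<Rightarrow> 'd::ab_group_add) \<Rightarrow>
   ('a \<Rightarrow> 'c) \<Rightarrow> ('b \<Rightarrow> 'd) \<Rightarrow> ('k, 'a, 'b) tensor \<Rightarrow> ('k, 'c, 'd) tensor" where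
  "tmap s1 s2 f g t = tclass s1 s2 (sw fscale t (\<lambda>x y. gen (f x, g y)))"

text \<open>Linear maps \<open>V \<otimes> W \<rightarrow> U\<close> are represented by bilinear maps \<open>V \<rightarrow> W \<rightarrow> U\<close>.\<close>

definition bilin_on ::
  "'a set \<Rightarrow> 'b set \<Rightarrow> ('k \<Rightarrow> 'a \<Rightarrow> 'a::ab_group_add) \<Rightarrow> ('k \<Rightarrow> 'b \<Rightarrow> 'b::ab_group_add) \<Rightarrow>
   ('k \<Rightarrow> 'c \<Rightarrow> 'c::ab_group_add) \<Rightarrow> ('a \<Rightarrow> 'b \<Rightarrow> 'c) \<Rightarrow> bool" where
  "bilin_on V W s1 s2 s3 f \<longleftrightarrow>
     (\<forall>x\<in>V. \<forall>x'\<in>V. \<forall>y\<in>W. f (x + x') y = f x y + f x' y) \<and>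
     (\<forall>x\<in>V. \<forall>y\<in>W. \<forall>y'\<in>W. f x (y + y') = f x y + f x y') \<and>
     (\<forall>c. \<forall>x\<in>V. \<forall>y\<in>W. f (s1 c x) y = s3 c (f x y)) \<and>
     (\<forall>c. \<forall>x\<in>V. \<forall>y\<in>W. f x (s2 c y) = s3 c (f x y))"

text \<open>The linear maps from a vector space to a tensor product, expressed on representatives.\<close>

definition linear_to_tensor ::
  "('k::field \<Rightarrow> 'c \<Rightarrow> 'c::ab_group_add) \<Rightarrow> ('k \<Rightarrow> 'a \<Rightarrow> 'a::ab_group_add) \<Rightarrow>
   ('k \<Rightarrow> 'b \<Rightarrow> 'b::ab_group_add) \<Rightarrow> ('c \<Rightarrow> ('k, 'a, 'b) tensor) \<Rightarrow> bool" where
  "linear_to_tensor s0 s1 s2 D \<longleftrightarrow>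
     (\<forall>x. D x \<in> range (tclass s1 s2)) \<and>
     (\<forall>x y p q. p \<in> D x \<longrightarrow> q \<in> D y \<longrightarrow> p + q \<in> D (x + y)) \<and>
     (\<forall>c x p. p \<in> D x \<longrightarrow> fscale c p \<in> D (s0 c x))"


section \<open>Bialgebras, Hopf algebras and splitting data\<close>

record (overloaded) ('k::field, 'a) bialg =
  scl :: "'k \<Rightarrow> 'a \<Rightarrow> 'a"
  mul :: "'a \<Rightarrow> 'a \<Rightarrow> 'a"
  unity :: 'a
  comul :: "'a \<Rightarrow> ('k, 'a, 'a) tensor"
  counit :: "'a \<Rightarrow> 'k"

record (overloaded) ('k::field, 'h) hopf = "('k, 'h) bialg" +
  antipode :: "'h \<Rightarrow> 'h"

definition unital_algebra :: "('k::field, 'a::ab_group_add, 'm) bialg_scheme \<Rightarrow> bool" where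
  "unital_algebra A \<longleftrightarrow>
     vector_space (scl A) \<and>
     bilin_on UNIV UNIV (scl A) (scl A) (scl A) (mul A) \<and>
     (\<forall>x y z. mul A (mul A x y) z = mul A x (mul A y z)) \<and>
     (\<forall>x. mul A (unity A) x = x \<and> mul A x (unity A) = x)"

definition coalgebra :: "('k::field, 'a::ab_group_add, 'm) bialg_scheme \<Rightarrow> bool" where
  "coalgebra C \<longleftrightarrow>
     vector_space (scl C) \<and>
     linear_to_tensor (scl C) (scl C) (scl C) (comul C) \<and>
     Vector_Spaces.linear (scl C) (*) (counit C) \<and>
     (\<forall>a. tclass3 (scl C) (scl C) (scl C)
             (sw fscale (comul C a) (\<lambda>x z. sw fscale (comul C x) (\<lambda>x1 x2. gen (x1, x2, z))))
         = tclass3 (scl C) (scl C) (scl C)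
             (sw fscale (comul C a) (\<lambda>x z. sw fscale (comul C z) (\<lambda>z1 z2. gen (x, z1, z2))))) \<and>
     (\<forall>a. sw (scl C) (comul C a) (\<lambda>x y. scl C (counit C x) y) = a) \<and>
     (\<forall>a. sw (scl C) (comul C a) (\<lambda>x y. scl C (counit C y) x) = a)"

definition bialgebra :: "('k::field, 'a::ab_group_add, 'm) bialg_scheme \<Rightarrow> bool" where
  "bialgebra A \<longleftrightarrow>
     unital_algebra A \<and> coalgebra A \<and>
     (\<forall>a b. comul A (mul A a b) =
        tclass (scl A) (scl A)
          (sw fscale (comul A a) (\<lambda>a1 a2. sw fscale (comul A b) (\<lambda>b1 b2.
             gen (mul A a1 b1, mul A a2 b2))))) \<and>
     comul A (unity A) = pure_tensor (scl A) (scl A) (unity A) (unity A) \<and>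
     (\<forall>a b. counit A (mul A a b) = counit A a * counit A b) \<and>
     counit A (unity A) = 1"

definition hopf_algebra :: "('k::field, 'h::ab_group_add, 'm) hopf_scheme \<Rightarrow> bool" where
  "hopf_algebra H \<longleftrightarrow>
     bialgebra H \<and>
     Vector_Spaces.linear (scl H) (scl H) (antipode H) \<and>
     (\<forall>h. sw (scl H) (comul H h) (\<lambda>u v. mul H (antipode H u) v) = scl H (counit H h) (unity H)) \<and>
     (\<forall>h. sw (scl H) (comul H h) (\<lambda>u v. mul H u (antipode H v)) = scl H (counit H h) (unity H))"

definition coalgebra_hom ::
  "('k::field, 'a::ab_group_add, 'm) bialg_scheme \<Rightarrow> ('k, 'b::ab_group_add, 'n) bialg_scheme \<Rightarrow>
   ('a \<Rightarrow> 'b) \<Rightarrow> bool" where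
  "coalgebra_hom C D f \<longleftrightarrow>
     Vector_Spaces.linear (scl C) (scl D) f \<and>
     (\<forall>a. comul D (f a) = tmap (scl D) (scl D) f f (comul C a)) \<and>
     (\<forall>a. counit D (f a) = counit C a)"

definition bialgebra_hom ::
  "('k::field, 'a::ab_group_add, 'm) bialg_scheme \<Rightarrow> ('k, 'b::ab_group_add, 'n) bialg_scheme \<Rightarrow>
   ('a \<Rightarrow> 'b) \<Rightarrow> bool" where
  "bialgebra_hom A B f \<longleftrightarrow>
     coalgebra_hom A B f \<and>
     (\<forall>x y. f (mul A x y) = mul B (f x) (f y)) \<and>
     f (unity A) = unity B"

definition splitting_datum ::
  "('k::field, 'a::ab_group_add) bialg \<Rightarrow> ('k, 'h::ab_group_add) hopf \<Rightarrow>
   ('a \<Rightarrow> 'h) \<Rightarrow> ('h \<Rightarrow> 'a) \<Rightarrow> bool" where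
  "splitting_datum A H \<pi> \<sigma> \<longleftrightarrow>
     bialgebra A \<and>
     bialgebra_hom H A \<sigma> \<and>
     coalgebra_hom A H \<pi> \<and>
     (\<forall>h. \<pi> (\<sigma> h) = h) \<and>
     (\<forall>h x h'. \<pi> (mul A (mul A (\<sigma> h) x) (\<sigma> h')) = mul H (mul H h (\<pi> x)) h')"


section \<open>The associated pre-bialgebra with cocycle\<close>

text \<open>
  The structure maps of such an object are only meaningful on the subspace \<open>car\<close>; they are
  extensional (\<^const>\<open>undefined\<close> outside), so that equality of records is equality of
  structures.  Tensors over the subspace are taken inside the tensor product of the ambient spaces.
\<close>

record (overloaded) ('k::field, 'h, 'r) yd_prebialg = "('k, 'r) bialg" +
  car :: "'r set"
  act :: "'h \<Rightarrow> 'r \<Rightarrow> 'r"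
  coact :: "'r \<Rightarrow> ('k, 'h, 'r) tensor"

definition restrict2 :: "'r set \<Rightarrow> ('r \<Rightarrow> 'r \<Rightarrow> 'b) \<Rightarrow> 'r \<Rightarrow> 'r \<Rightarrow> 'b" where
  "restrict2 R f = (\<lambda>r\<in>R. \<lambda>s\<in>R. f r s)"

definition coinvariants ::
  "('k::field, 'a::ab_group_add) bialg \<Rightarrow> ('k, 'h::ab_group_add) hopf \<Rightarrow> ('a \<Rightarrow> 'h) \<Rightarrow> 'a set" where
  "coinvariants A H \<pi> =
     {a. tmap (scl A) (scl H) id \<pi> (comul A a) = pure_tensor (scl A) (scl H) a (unity H)}"

definition tau_map ::
  "('k::field, 'a::ab_group_add) bialg \<Rightarrow> ('k, 'h::ab_group_add) hopf \<Rightarrow>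
   ('a \<Rightarrow> 'h) \<Rightarrow> ('h \<Rightarrow> 'a) \<Rightarrow> 'a \<Rightarrow> 'a" where
  "tau_map A H \<pi> \<sigma> a =
     sw (scl A) (comul A a) (\<lambda>a1 a2. mul A a1 (\<sigma> (antipode H (\<pi> a2))))"

definition associated_R ::
  "('k::field, 'a::ab_group_add) bialg \<Rightarrow> ('k, 'h::ab_group_add) hopf \<Rightarrow>
   ('a \<Rightarrow> 'h) \<Rightarrow> ('h \<Rightarrow> 'a) \<Rightarrow> ('k, 'h, 'a) yd_prebialg" where
  "associated_R A H \<pi> \<sigma> =
     (let R = coinvariants A H \<pi>; \<tau> = tau_map A H \<pi> \<sigma> in
      \<lparr> scl = scl A,
        mul = restrict2 R (\<lambda>r s. \<tau> (mul A r s)),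
        unity = unity A,
        comul = (\<lambda>r\<in>R. tmap (scl A) (scl A) \<tau> id (comul A r)),
        counit = (\<lambda>r\<in>R. counit A r),
        car = R,
        act = (\<lambda>h. \<lambda>r\<in>R. sw (scl A) (comul H h)
                 (\<lambda>h1 h2. mul A (mul A (\<sigma> h1) r) (\<sigma> (antipode H h2)))),
        coact = (\<lambda>r\<in>R. tmap (scl H) (scl A) \<pi> id (comul A r)) \<rparr>)"

definition associated_cocycle ::
  "('k::field, 'a::ab_group_add) bialg \<Rightarrow> ('k, 'h::ab_group_add) hopf \<Rightarrow>
   ('a \<Rightarrow> 'h) \<Rightarrow> 'a \<Rightarrow> 'a \<Rightarrow> 'h" where
  "associated_cocycle A H \<pi> = restrict2 (coinvariants A H \<pi>) (\<lambda>r s. \<pi> (mul A r s))"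

definition associated_prebialgebra ::
  "('k::field, 'a::ab_group_add) bialg \<Rightarrow> ('k, 'h::ab_group_add) hopf \<Rightarrow>
   ('a \<Rightarrow> 'h) \<Rightarrow> ('h \<Rightarrow> 'a) \<Rightarrow> ('k, 'h, 'a) yd_prebialg \<times> ('a \<Rightarrow> 'a \<Rightarrow> 'h)" where
  "associated_prebialgebra A H \<pi> \<sigma> = (associated_R A H \<pi> \<sigma>, associated_cocycle A H \<pi>)"


section \<open>Cocycles and the twist of the bialgebra\<close>

definition conv_A ::
  "('k::field, 'a::ab_group_add) bialg \<Rightarrow> ('a \<Rightarrow> 'a \<Rightarrow> 'k) \<Rightarrow> ('a \<Rightarrow> 'a \<Rightarrow> 'k) \<Rightarrow> 'a \<Rightarrow> 'a \<Rightarrow> 'k" where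
  "conv_A A f g x y =
     sw (*) (comul A x) (\<lambda>x1 x2. sw (*) (comul A y) (\<lambda>y1 y2. f x1 y1 * g x2 y2))"

definition conv_inverse_A ::
  "('k::field, 'a::ab_group_add) bialg \<Rightarrow> ('a \<Rightarrow> 'a \<Rightarrow> 'k) \<Rightarrow> ('a \<Rightarrow> 'a \<Rightarrow> 'k) \<Rightarrow> bool" where
  "conv_inverse_A A f g \<longleftrightarrow>
     bilin_on UNIV UNIV (scl A) (scl A) (*) g \<and>
     (\<forall>x y. conv_A A f g x y = counit A x * counit A y) \<and>
     (\<forall>x y. conv_A A g f x y = counit A x * counit A y)"

definition inv_A ::
  "('k::field, 'a::ab_group_add) bialg \<Rightarrow> ('a \<Rightarrow> 'a \<Rightarrow> 'k) \<Rightarrow> 'a \<Rightarrow> 'a \<Rightarrow> 'k" where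
  "inv_A A f = (THE g. conv_inverse_A A f g)"

definition Z2 ::
  "('k::field, 'a::ab_group_add) bialg \<Rightarrow> ('k, 'h::ab_group_add) hopf \<Rightarrow> ('h \<Rightarrow> 'a) \<Rightarrow>
   ('a \<Rightarrow> 'a \<Rightarrow> 'k) set" where
  "Z2 A H \<sigma> = {\<gamma>.
     bilin_on UNIV UNIV (scl A) (scl A) (*) \<gamma> \<and>
     (\<exists>g. conv_inverse_A A \<gamma> g) \<and>
     (\<forall>x y z.
        sw (*) (comul A y) (\<lambda>y1 y2. sw (*) (comul A z) (\<lambda>z1 z2. \<gamma> y1 z1 * \<gamma> x (mul A y2 z2)))
      = sw (*) (comul A x) (\<lambda>x1 x2. sw (*) (comul A y) (\<lambda>y1 y2. \<gamma> x1 y1 * \<gamma> (mul A x2 y2) z))) \<and>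
     (\<forall>x. \<gamma> x (unity A) = counit A x \<and> \<gamma> (unity A) x = counit A x) \<and>
     (\<forall>h a a' h'. \<gamma> (mul A (\<sigma> h) a) (mul A a' (\<sigma> h')) = counit H h * \<gamma> a a' * counit H h')}"

definition twist_A ::
  "('k::field, 'a::ab_group_add) bialg \<Rightarrow> ('a \<Rightarrow> 'a \<Rightarrow> 'k) \<Rightarrow> ('k, 'a) bialg" where
  "twist_A A \<gamma> = A\<lparr> mul := (\<lambda>x y.
     sw (scl A) (comul A x) (\<lambda>x1 x'. sw (scl A) (comul A x') (\<lambda>x2 x3.
     sw (scl A) (comul A y) (\<lambda>y1 y'. sw (scl A) (comul A y') (\<lambda>y2 y3.
       scl A (\<gamma> x1 y1 * inv_A A \<gamma> x3 y3) (mul A x2 y2)))))) \<rparr>"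


section \<open>Convolution on the braided tensor square and the twist of the pre-bialgebra\<close>

text \<open>
  \<open>sw_RR R s x y \<Phi>\<close> evaluates the linear map induced by the 4-linear map \<open>\<Phi>\<close> at
  \<open>\<Delta>\<^bsub>R\<otimes>R\<^esub>(x \<otimes> y)\<close>.
\<close>

definition sw_RR ::
  "('k::field, 'h::ab_group_add, 'r::ab_group_add) yd_prebialg \<Rightarrow>
   ('k \<Rightarrow> 'v \<Rightarrow> 'v::ab_group_add) \<Rightarrow> 'r \<Rightarrow> 'r \<Rightarrow> ('r \<Rightarrow> 'r \<Rightarrow> 'r \<Rightarrow> 'r \<Rightarrow> 'v) \<Rightarrow> 'v" where
  "sw_RR R s x y \<Phi> =
     sw_on (car R) (car R) s (comul R x) (\<lambda>x1 x2.
     sw_on UNIV (car R) s (coact R x2) (\<lambda>h x20.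
     sw_on (car R) (car R) s (comul R y) (\<lambda>y1 y2.
       \<Phi> x1 (act R h y1) x20 y2)))"

text \<open>Convolution of maps \<open>R \<otimes> R \<rightarrow> B\<close> for an algebra \<open>B\<close> with scalar multiplication \<open>s\<close> and
  product \<open>m\<close>.\<close>

definition conv_RR ::
  "('k::field, 'h::ab_group_add, 'r::ab_group_add) yd_prebialg \<Rightarrow>
   ('k \<Rightarrow> 'b \<Rightarrow> 'b::ab_group_add) \<Rightarrow> ('b \<Rightarrow> 'b \<Rightarrow> 'b) \<Rightarrow>
   ('r \<Rightarrow> 'r \<Rightarrow> 'b) \<Rightarrow> ('r \<Rightarrow> 'r \<Rightarrow> 'b) \<Rightarrow> 'r \<Rightarrow> 'r \<Rightarrow> 'b" where
  "conv_RR R s m f g x y = sw_RR R s x y (\<lambda>x1 y1 x2 y2. m (f x1 y1) (g x2 y2))"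

definition conv_inverse_RR ::
  "('k::field, 'h::ab_group_add, 'r::ab_group_add) yd_prebialg \<Rightarrow>
   ('r \<Rightarrow> 'r \<Rightarrow> 'k) \<Rightarrow> ('r \<Rightarrow> 'r \<Rightarrow> 'k) \<Rightarrow> bool" where
  "conv_inverse_RR R f g \<longleftrightarrow>
     restrict2 (car R) g = g \<and>
     bilin_on (car R) (car R) (scl R) (scl R) (*) g \<and>
     (\<forall>x\<in>car R. \<forall>y\<in>car R. conv_RR R (*) (*) f g x y = counit R x * counit R y) \<and>
     (\<forall>x\<in>car R. \<forall>y\<in>car R. conv_RR R (*) (*) g f x y = counit R x * counit R y)"

definition inv_RR ::
  "('k::field, 'h::ab_group_add, 'r::ab_group_add) yd_prebialg \<Rightarrow>
   ('r \<Rightarrow> 'r \<Rightarrow> 'k) \<Rightarrow> 'r \<Rightarrow> 'r \<Rightarrow> 'k" where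
  "inv_RR R f = (THE g. conv_inverse_RR R f g)"

definition twist_R ::
  "('k::field, 'h::ab_group_add, 'r::ab_group_add) yd_prebialg \<Rightarrow>
   ('r \<Rightarrow> 'r \<Rightarrow> 'k) \<Rightarrow> ('k, 'h, 'r) yd_prebialg" where
  "twist_R R g = R\<lparr> mul := restrict2 (car R) (\<lambda>x y.
     sw_RR R (scl R) x y (\<lambda>x' y' x3 y3. sw_RR R (scl R) x' y' (\<lambda>x1 y1 x2 y2.
       scl R (g x1 y1 * inv_RR R g x3 y3) (mul R x2 y2)))) \<rparr>"

definition unit_after ::
  "('k::field, 'h::ab_group_add) hopf \<Rightarrow> ('r \<Rightarrow> 'r \<Rightarrow> 'k) \<Rightarrow> 'r \<Rightarrow> 'r \<Rightarrow> 'h" where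
  "unit_after H g x y = scl H (g x y) (unity H)"

text \<open>The map \<open>(H \<otimes> g) \<rho>\<^bsub>R\<otimes>R\<^esub>\<close> for the codiagonal coaction.\<close>

definition after_coact_RR ::
  "('k::field, 'h::ab_group_add) hopf \<Rightarrow> ('k, 'h, 'r::ab_group_add) yd_prebialg \<Rightarrow>
   ('r \<Rightarrow> 'r \<Rightarrow> 'k) \<Rightarrow> 'r \<Rightarrow> 'r \<Rightarrow> 'h" where
  "after_coact_RR H R g x y =
     sw_on UNIV (car R) (scl H) (coact R x) (\<lambda>h x0.
     sw_on UNIV (car R) (scl H) (coact R y) (\<lambda>h' y0.
       scl H (g x0 y0) (mul H h h')))"

definition twist_cocycle ::
  "('k::field, 'h::ab_group_add) hopf \<Rightarrow> ('k, 'h, 'r::ab_group_add) yd_prebialg \<Rightarrow>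
   ('r \<Rightarrow> 'r \<Rightarrow> 'k) \<Rightarrow> ('r \<Rightarrow> 'r \<Rightarrow> 'h) \<Rightarrow> 'r \<Rightarrow> 'r \<Rightarrow> 'h" where
  "twist_cocycle H R g \<xi> = restrict2 (car R)
     (conv_RR R (scl H) (mul H)
        (conv_RR R (scl H) (mul H) (unit_after H g) \<xi>)
        (after_coact_RR H R (inv_RR R g)))"

end

(*
  Every a in A is tau(a_1) sigma(pi(a_2)).  Hence a bilinear map F on A x A with
  F(a sigma(h), b) = F(a, sigma(h) b) and F(a, b sigma(h)) = eps(h) F(a, b) is determined by its
  restriction to R x R, every bilinear map on R x R has such an extension, and on these maps the
  braided comultiplication of R (x) R may be replaced by the plain one of A (x) A.  The cocycle
  gamma has the two properties (the first is the cocycle condition with middle argument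
  sigma(h)), and so has its inverse by uniqueness of convolution inverses.  The multiplication of
  the twisted R is thereby computed in A, and tau, the action and the coaction do not change
  since x *_gamma sigma(h) = x sigma(h).  For xi the right invariance fails, but the resulting
  factors S(pi(y_2)) S(pi(x_2)) cancel against the coaction pi(x_3) pi(y_3).
*)
theory Submission
  imports Defs
begin

section \<open>Linear maps on tensor products\<close>

text \<open>A Sweedler sum here evaluates one chosen representative of a coset, so almost every
  rewriting carries the side condition that the integrand is linear in each variable; equality of
  tensors is tested against scalar-valued bilinear maps, which separate cosets. The structure maps
  of R are \<open>undefined\<close> outside R, so integrands built from them need not be bilinear on
  A. Each is exchanged for a total multilinear map that agrees with it on R: \<tau>(xy),
  \<tau>(\<sigma>(h)x) and \<pi>(xy) make sense for all arguments in A. The braiding disappears for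
  this reason: the action on y1 has the form \<sigma>(k1) \<tau>(y1) \<sigma>(S(k2)) with k =
  \<pi>(x2). Balance hands \<sigma>(k1) to the first argument, where it completes \<tau>(x1) to x1,
  and right invariance erases what stands to the right of y1. The inverse used by the twist of R is
  a definite description, so uniqueness on R has to be proved as well: a competing inverse is
  extended to A, where it must coincide with the inverse of \<gamma>.\<close>

abbreviation lin :: "('k::field \<Rightarrow> 'a \<Rightarrow> 'a::ab_group_add) \<Rightarrow> ('k \<Rightarrow> 'b \<Rightarrow> 'b::ab_group_add) \<Rightarrow> ('a \<Rightarrow> 'b) \<Rightarrow> bool" where
  "lin \<equiv> Vector_Spaces.linear"

lemma lin_iff:
  "lin s1 s2 f \<longleftrightarrow> vector_space s1 \<and> vector_space s2 \<and>
     (\<forall>x y. f (x + y) = f x + f y) \<and> (\<forall>c x. f (s1 c x) = s2 c (f x))"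
  by (auto simp: Vector_Spaces.linear_def module_hom_def module_hom_axioms_def
      vector_space_def module_def)

lemma linI:
  assumes "vector_space s1" "vector_space s2"
    "\<And>x y. f (x + y) = f x + f y" "\<And>c x. f (s1 c x) = s2 c (f x)"
  shows "lin s1 s2 f"
  using assms by (simp add: lin_iff)

lemma linD:
  assumes "lin s1 s2 f"
  shows "f (x + y) = f x + f y" "f (s1 c x) = s2 c (f x)" "f 0 = 0" "f (x - y) = f x - f y"
    "f (sum g I) = (\<Sum>i\<in>I. f (g i))"
proof -
  interpret Vector_Spaces.linear s1 s2 f by fact
  show "f (x + y) = f x + f y" "f (s1 c x) = s2 c (f x)" "f 0 = 0" "f (x - y) = f x - f y"
    "f (sum g I) = (\<Sum>i\<in>I. f (g i))"
    by (simp_all add: add scale zero diff sum)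
qed

lemma vs_field: "vector_space ((*) :: 'k::field \<Rightarrow> 'k \<Rightarrow> 'k)"
  by (unfold_locales) (simp_all add: algebra_simps)

lemma vs_simps:
  assumes "vector_space s"
  shows "s c (x + y) = s c x + s c y" "s (c + d) x = s c x + s d x"
    "s c (s d x) = s (c * d) x" "s 1 x = x" "s 0 x = 0" "s c 0 = 0"
    "s c (sum f I) = (\<Sum>i\<in>I. s c (f i))" "s c (x - y) = s c x - s c y"
proof -
  interpret vector_space s by fact
  show "s c (x + y) = s c x + s c y" "s (c + d) x = s c x + s d x"
    "s c (s d x) = s (c * d) x" "s 1 x = x" "s 0 x = 0" "s c 0 = 0"
    "s c (sum f I) = (\<Sum>i\<in>I. s c (f i))" "s c (x - y) = s c x - s c y"
    by (simp_all add: scale_right_distrib scale_left_distrib scale_sum_right scale_right_diff_distrib)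
qed

lemma lookup_fscale [simp]: "Poly_Mapping.lookup (fscale c p) x = c * Poly_Mapping.lookup p x"
  by (simp add: fscale_def Poly_Mapping.map.rep_eq when_def)

lemma vs_fscale: "vector_space (fscale :: 'k::field \<Rightarrow> ('x \<Rightarrow>\<^sub>0 'k) \<Rightarrow> _)"
  by unfold_locales (auto intro!: poly_mapping_eqI simp: lookup_add algebra_simps)

lemma lin_ext_superset:
  assumes "vector_space s" "finite B" "Poly_Mapping.keys p \<subseteq> B"
  shows "lin_ext s F p = (\<Sum>x\<in>B. s (Poly_Mapping.lookup p x) (F x))"
  unfolding lin_ext_def
  by (rule sum.mono_neutral_left)
    (use assms in \<open>auto simp: in_keys_iff vs_simps[OF assms(1)]\<close>)

lemma linear_lin_ext:
  fixes F :: "'x \<Rightarrow> 'v::ab_group_add" and s :: "'k::field \<Rightarrow> 'v \<Rightarrow> 'v"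
  assumes s: "vector_space s"
  shows "lin fscale s (lin_ext s F)"
proof (rule linI[OF vs_fscale s])
  fix p q :: "'x \<Rightarrow>\<^sub>0 'k"
  let ?B = "Poly_Mapping.keys p \<union> Poly_Mapping.keys q"
  have "Poly_Mapping.keys (p + q) \<subseteq> ?B" by (rule keys_add)
  then show "lin_ext s F (p + q) = lin_ext s F p + lin_ext s F q"
    by (simp add: lin_ext_superset[OF s, of ?B] lookup_add vs_simps[OF s] sum.distrib)
next
  fix c and p :: "'x \<Rightarrow>\<^sub>0 'k"
  have "Poly_Mapping.keys (fscale c p) \<subseteq> Poly_Mapping.keys p"
    by (auto simp: in_keys_iff)
  then show "lin_ext s F (fscale c p) = s c (lin_ext s F p)"
    by (simp add: lin_ext_superset[OF s, of "Poly_Mapping.keys p"] vs_simps[OF s])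
qed

lemma lin_ext_gen [simp]: "vector_space s \<Longrightarrow> lin_ext s F (gen x) = F x"
  by (simp add: lin_ext_def vs_simps)

lemma lin_ext_cong: "(\<And>x. x \<in> Poly_Mapping.keys p \<Longrightarrow> F x = G x) \<Longrightarrow> lin_ext s F p = lin_ext s G p"
  by (simp add: lin_ext_def)

lemma lin_ext_zero_span:
  assumes s: "vector_space s" and "p \<in> module.span fscale B" "\<And>b. b \<in> B \<Longrightarrow> lin_ext s F b = 0"
  shows "lin_ext s F p = 0"
proof -
  interpret fs: vector_space "fscale :: 'k::field \<Rightarrow> ('x \<Rightarrow>\<^sub>0 'k) \<Rightarrow> _" by (rule vs_fscale)
  note l = linD[OF linear_lin_ext[OF s]]
  show ?thesis
    using assms(2)
  proof (induction rule: fs.span_induct_alt)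
    case base show ?case by (rule l)
  next
    case (step c x y)
    then show ?case by (simp add: l assms vs_simps[OF s])
  qed
qed

lemma lin_ext_zero_tensor_null:
  assumes "\<And>y. lin s1 s (\<lambda>x. F x y)" "\<And>x. lin s2 s (\<lambda>y. F x y)" "p \<in> tensor_null s1 s2"
  shows "lin_ext s (\<lambda>(x, y). F x y) p = 0"
proof -
  have s: "vector_space s" using assms(1) by (auto simp: lin_iff)
  note l = linD[OF linear_lin_ext[OF s]]
  show ?thesis
    using assms(3) unfolding tensor_null_def
    by (rule lin_ext_zero_span[OF s])
      (auto simp: l lin_ext_gen[OF s] linD(1,2)[OF assms(1)] linD(1,2)[OF assms(2)])
qed

lemma lin_ext_zero_tensor_null3:
  assumes "\<And>y z. lin s1 s (\<lambda>x. F x y z)" "\<And>x z. lin s2 s (\<lambda>y. F x y z)" 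
    "\<And>x y. lin s3 s (\<lambda>z. F x y z)" "p \<in> tensor_null3 s1 s2 s3"
  shows "lin_ext s (\<lambda>(x, y, z). F x y z) p = 0"
proof -
  have s: "vector_space s" using assms(1) by (auto simp: lin_iff)
  note l = linD[OF linear_lin_ext[OF s]]
  show ?thesis
    using assms(4) unfolding tensor_null3_def
    by (rule lin_ext_zero_span[OF s])
      (auto simp: l lin_ext_gen[OF s] linD(1,2)[OF assms(1)] linD(1,2)[OF assms(2)] linD(1,2)[OF assms(3)])
qed

lemma fspan_zero: "0 \<in> module.span (fscale :: 'k::field \<Rightarrow> ('x \<Rightarrow>\<^sub>0 'k) \<Rightarrow> _) B"
  by (rule module.span_zero) (use vs_fscale in \<open>auto simp: vector_space_def module_def\<close>)

lemma tclass_refl: "p \<in> tclass s1 s2 p"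
  by (simp add: tclass_def tensor_null_def fspan_zero)

lemma tclass3_refl: "p \<in> tclass3 s1 s2 s3 p"
  by (simp add: tclass3_def tensor_null3_def fspan_zero)

lemma lin_ext_tclass:
  assumes "\<And>y. lin s1 s (\<lambda>x. F x y)" "\<And>x. lin s2 s (\<lambda>y. F x y)"
    and "p \<in> tclass s1 s2 q"
  shows "lin_ext s (\<lambda>(x, y). F x y) p = lin_ext s (\<lambda>(x, y). F x y) q"
proof -
  have s: "vector_space s" using assms(1) by (auto simp: lin_iff)
  have "lin_ext s (\<lambda>(x, y). F x y) (p - q) = 0"
    using assms by (intro lin_ext_zero_tensor_null) (auto simp: tclass_def)
  then show ?thesis by (simp add: linD[OF linear_lin_ext[OF s]])
qed

lemma sw_tclass:
  assumes "\<And>y. lin s1 s (\<lambda>x. F x y)" "\<And>x. lin s2 s (\<lambda>y. F x y)"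
  shows "sw s (tclass s1 s2 p) F = lin_ext s (\<lambda>(x, y). F x y) p"
proof -
  have "(SOME q. q \<in> tclass s1 s2 p \<and> Poly_Mapping.keys q \<subseteq> UNIV \<times> UNIV) \<in> tclass s1 s2 p"
    by (rule someI2[of _ p]) (auto simp: tclass_refl)
  then show ?thesis unfolding sw_on_def
    by (rule lin_ext_tclass[OF assms])
qed

lemma sw_eq:
  assumes "\<And>y. lin s1 s (\<lambda>x. F x y)" "\<And>x. lin s2 s (\<lambda>y. F x y)"
    and "t \<in> range (tclass s1 s2)" "p \<in> t"
  shows "sw s t F = lin_ext s (\<lambda>(x, y). F x y) p"
proof -
  obtain q where q: "t = tclass s1 s2 q" using assms(3) by auto
  show ?thesis using lin_ext_tclass[OF assms(1,2), of p q] assms(4)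
    by (simp add: q sw_tclass[OF assms(1,2)])
qed

text \<open>This is the passage from partial to total integrands. The representative
  \<open>p\<close> shows that the choice in \<open>sw_on\<close> really picks one supported on V x
  W, where F and G agree; for the bilinear G the choice no longer matters.\<close>

lemma sw_on_subspace:
  assumes "\<And>y. lin s1 s (\<lambda>x. G x y)" "\<And>x. lin s2 s (\<lambda>y. G x y)"
    and "t \<in> range (tclass s1 s2)" "p \<in> t" "Poly_Mapping.keys p \<subseteq> V \<times> W"
    and "\<And>x y. x \<in> V \<Longrightarrow> y \<in> W \<Longrightarrow> F x y = G x y"
  shows "sw_on V W s t F = sw s t G"
proof -
  define q where "q = (SOME p. p \<in> t \<and> Poly_Mapping.keys p \<subseteq> V \<times> W)"
  have q: "q \<in> t \<and> Poly_Mapping.keys q \<subseteq> V \<times> W"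
    unfolding q_def by (rule someI[of _ p]) (use assms in auto)
  have "sw_on V W s t F = lin_ext s (\<lambda>(x, y). F x y) q" by (simp add: sw_on_def q_def)
  also have "\<dots> = lin_ext s (\<lambda>(x, y). G x y) q"
    by (rule lin_ext_cong) (use q assms(6) in auto)
  also have "\<dots> = sw s t G" by (rule sw_eq[symmetric]) (use assms q in auto)
  finally show ?thesis .
qed

lemma sw_linear_image:
  assumes "lin s s' L"
  shows "L (sw_on V W s t F) = sw_on V W s' t (\<lambda>x y. L (F x y))"
  by (simp add: sw_on_def lin_ext_def linD[OF assms] case_prod_beta)

lemma sw_add:
  assumes "vector_space s"
  shows "sw_on V W s t (\<lambda>x y. F x y + G x y) = sw_on V W s t F + sw_on V W s t G"
  by (simp add: sw_on_def lin_ext_def vs_simps[OF assms] sum.distrib case_prod_beta)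

lemma sw_scale:
  assumes "vector_space s"
  shows "sw_on V W s t (\<lambda>x y. s c (F x y)) = s c (sw_on V W s t F)"
  by (simp add: sw_on_def lin_ext_def vs_simps[OF assms] case_prod_beta mult.commute)

text \<open>Both sides are finite double sums over the two chosen representatives, so they can be
  interchanged for arbitrary F.\<close>

lemma sw_swap:
  assumes "vector_space s"
  shows "sw s t (\<lambda>x y. sw s t' (\<lambda>u v. F x y u v)) = sw s t' (\<lambda>u v. sw s t (\<lambda>x y. F x y u v))"
  unfolding sw_on_def lin_ext_def case_prod_beta vs_simps(7,3)[OF assms]
  by (subst sum.swap) (simp add: mult.commute)

lemma sw_mult_right: "sw (*) t F * (r::'k::field) = sw (*) t (\<lambda>x y. F x y * r)"
  by (rule sw_linear_image[of "(*)" "(*)" "\<lambda>c. c * r"])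
   (auto intro!: linI vs_field simp: algebra_simps)

lemma sw_mult_left: "(r::'k::field) * sw (*) t F = sw (*) t (\<lambda>x y. r * F x y)"
  by (rule sw_linear_image[of "(*)" "(*)" "\<lambda>c. r * c"])
   (auto intro!: linI vs_field simp: algebra_simps)

lemma linear_sw_param:
  assumes "\<And>u v. lin s0 s (\<lambda>x. G x u v)"
  shows "lin s0 s (\<lambda>x. sw s t (\<lambda>u v. G x u v))"
proof -
  have "vector_space s0" "vector_space s" using assms by (auto simp: lin_iff)
  then show ?thesis
    by (intro linI) (simp_all add: linD(1,2)[OF assms] sw_add sw_scale)
qed

lemma tmap_in_range: "tmap s1 s2 f g t \<in> range (tclass s1 s2)"
  by (simp add: tmap_def)

lemma lin_ext_gen_keys:
  "Poly_Mapping.keys (lin_ext fscale (\<lambda>(x, y). gen (f x, g y)) p) \<subseteq> range f \<times> range g"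
proof
  fix z assume "z \<in> Poly_Mapping.keys (lin_ext fscale (\<lambda>(x, y). gen (f x, g y)) p)"
  then have "(\<Sum>x\<in>Poly_Mapping.keys p. Poly_Mapping.lookup p x *
       Poly_Mapping.lookup (gen (f (fst x), g (snd x))) z) \<noteq> 0"
    by (simp add: lin_ext_def in_keys_iff lookup_sum case_prod_beta)
  then obtain x where "Poly_Mapping.lookup p x * Poly_Mapping.lookup (gen (f (fst x), g (snd x))) z \<noteq> 0"
    using sum.not_neutral_contains_not_neutral by blast
  then show "z \<in> range f \<times> range g"
    by (auto simp: lookup_single when_def split: if_splits)
qed

text \<open>Applied with f or g equal to \<tau>, this yields representatives supported on the
  coinvariants.\<close>

lemma tmap_keys:
  "\<exists>p \<in> tmap s1 s2 f g t. Poly_Mapping.keys p \<subseteq> range f \<times> range g"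
  unfolding tmap_def
  by (rule bexI[OF _ tclass_refl]) (simp add: sw_on_def lin_ext_gen_keys)

lemma sw_tmap:
  assumes "\<And>y. lin s1 s (\<lambda>x. F x y)" "\<And>x. lin s2 s (\<lambda>y. F x y)"
  shows "sw s (tmap s1 s2 f g t) F = sw s t (\<lambda>x y. F (f x) (g y))"
proof -
  have s: "vector_space s" using assms(1) by (auto simp: lin_iff)
  show ?thesis
    unfolding tmap_def sw_tclass[OF assms]
    by (subst sw_linear_image[OF linear_lin_ext[OF s]]) (simp add: s)
qed

lemma sw_pure_tensor:
  assumes "\<And>y. lin s1 s (\<lambda>x. F x y)" "\<And>x. lin s2 s (\<lambda>y. F x y)"
  shows "sw s (pure_tensor s1 s2 x y) F = F x y"
  using assms(1)[of undefined] unfolding pure_tensor_def sw_tclass[OF assms] by (simp add: lin_iff)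

text \<open>Bilinear forms separate tensors over a field: if p - q were not a relation, some linear
  functional would vanish on all relations and take the value 1 at p - q, and such a functional is a
  bilinear form on generators.\<close>

lemma tensor_eqI:
  fixes p q :: "('a::ab_group_add \<times> 'b::ab_group_add) \<Rightarrow>\<^sub>0 'k::field"
  assumes vs: "vector_space s1" "vector_space s2"
    and eq: "\<And>F. (\<And>y. lin s1 (*) (\<lambda>x. F x y)) \<Longrightarrow> (\<And>x. lin s2 (*) (\<lambda>y. F x y)) \<Longrightarrow>
      lin_ext (*) (\<lambda>(x, y). F x y) p = lin_ext (*) (\<lambda>(x, y). F x y) q"
  shows "tclass s1 s2 p = tclass s1 s2 q"
proof -
  interpret fs: vector_space "fscale :: 'k \<Rightarrow> (('a \<times> 'b) \<Rightarrow>\<^sub>0 'k) \<Rightarrow> _" by (rule vs_fscale)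
  interpret fk: vector_space_pair "fscale :: 'k \<Rightarrow> (('a \<times> 'b) \<Rightarrow>\<^sub>0 'k) \<Rightarrow> _" "(*) :: 'k \<Rightarrow> 'k \<Rightarrow> 'k"
    by (simp add: vector_space_pair_def vs_fscale vs_field)
  have sub: "fs.subspace (tensor_null s1 s2)"
    unfolding tensor_null_def by (rule fs.subspace_span)
  have mem: "p - q \<in> tensor_null s1 s2"
  proof (rule ccontr)
    assume notin: "p - q \<notin> tensor_null s1 s2"
    \<comment> \<open>A basis of the space of relations stays independent when p - q is adjoined, so
      a functional may be prescribed on the enlarged set.\<close>
    obtain B where B: "B \<subseteq> tensor_null s1 s2" "fs.independent B" "tensor_null s1 s2 \<subseteq> fs.span B"
      by (rule fs.maximal_independent_subset)
    have span: "fs.span B = tensor_null s1 s2"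
      using B fs.span_minimal[OF B(1) sub] by auto
    then have "fs.independent (insert (p - q) B)"
      using notin B(2) by (intro fs.independent_insertI) auto
    then obtain f where f: "lin fscale (*) f" "\<forall>x\<in>insert (p - q) B. f x = (if x = p - q then 1 else 0)"
      using fk.linear_independent_extend[of "insert (p - q) B" "\<lambda>x. if x = p - q then 1 else 0"] by auto
    have "p - q \<notin> B" using notin B by auto
    then have fB: "f x = 0" if "x \<in> B" for x
      using that f(2) by auto
    have f0: "f x = 0" if "x \<in> tensor_null s1 s2" for x
      using fk.linear_eq_0_on_span[OF f(1) fB, of B x] that span by auto
    have base: "f x = 0" if "x \<in> {gen (x + x', y) - gen (x, y) - gen (x', y) | x x' y. True}
      \<union> {gen (x, y + y') - gen (x, y) - gen (x, y') | x y y'. True}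
      \<union> {gen (s1 c x, y) - fscale c (gen (x, y)) | c x y. True}
      \<union> {gen (x, s2 c y) - fscale c (gen (x, y)) | c x y. True}" for x
      by (rule f0, unfold tensor_null_def, rule fs.span_base, rule that)
    have "lin s1 (*) (\<lambda>x. f (gen (x, y)))" for y
    proof (rule linI[OF vs(1) vs_field])
      fix x x' c
      show "f (gen (x + x', y)) = f (gen (x, y)) + f (gen (x', y))"
        proof -
        have "f (gen (x + x', y) - gen (x, y) - gen (x', y)) = 0" by (rule base) blast
        then show ?thesis by (simp add: linD[OF f(1)] algebra_simps)
      qed
      show "f (gen (s1 c x, y)) = c * f (gen (x, y))"
        proof -
        have "f (gen (s1 c x, y) - fscale c (gen (x, y))) = 0" by (rule base) blast
        then show ?thesis by (simp add: linD[OF f(1)] algebra_simps)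
      qed
    qed
    moreover have "lin s2 (*) (\<lambda>y. f (gen (x, y)))" for x
    proof (rule linI[OF vs(2) vs_field])
      fix y y' c
      show "f (gen (x, y + y')) = f (gen (x, y)) + f (gen (x, y'))"
        proof -
        have "f (gen (x, y + y') - gen (x, y) - gen (x, y')) = 0" by (rule base) blast
        then show ?thesis by (simp add: linD[OF f(1)] algebra_simps)
      qed
      show "f (gen (x, s2 c y)) = c * f (gen (x, y))"
        proof -
        have "f (gen (x, s2 c y) - fscale c (gen (x, y))) = 0" by (rule base) blast
        then show ?thesis by (simp add: linD[OF f(1)] algebra_simps)
      qed
    qed
    ultimately have e: "lin_ext (*) (\<lambda>(x, y). f (gen (x, y))) p = lin_ext (*) (\<lambda>(x, y). f (gen (x, y))) q"
      by (rule eq)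
    \<comment> \<open>The functional is the linear extension of its own values on generators, so the
      hypothesis \<open>eq\<close> does speak about it.\<close>
    have "lin_ext (*) (\<lambda>(x, y). f (gen (x, y))) r = f r" for r
    proof -
      have "f r = f (\<Sum>x\<in>Poly_Mapping.keys r. fscale (Poly_Mapping.lookup r x) (gen x))"
        by (rule arg_cong[of _ _ f], rule poly_mapping_eqI)
          (simp add: lookup_sum lookup_single when_def in_keys_iff if_distrib cong: if_cong)
      then show ?thesis by (simp add: lin_ext_def linD[OF f(1)] case_prod_beta)
    qed
    then have "f (p - q) = 0" using e by (simp add: linD[OF f(1)])
    then show False using f(2) by simp
  qed
  have "r - p \<in> tensor_null s1 s2 \<longleftrightarrow> r - q \<in> tensor_null s1 s2" for r
    using fs.subspace_add[OF sub, of "r - p" "p - q"] fs.subspace_diff[OF sub, of "r - q" "p - q"] mem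
    by auto
  then show ?thesis by (auto simp: tclass_def)
qed

section \<open>Sweedler calculus in coalgebras\<close>

lemma linear_ident: "vector_space s \<Longrightarrow> lin s s (\<lambda>x. x)"
  by (simp add: lin_iff)

lemma linear_comp: "lin s1 s2 f \<Longrightarrow> lin s0 s1 g \<Longrightarrow> lin s0 s2 (\<lambda>x. f (g x))"
  by (simp add: lin_iff)

lemma linear_mult_const:
  "lin s0 (*) f \<Longrightarrow> lin s0 (*) (\<lambda>x. f x * c)"
  "lin s0 (*) f \<Longrightarrow> lin s0 (*) (\<lambda>x. c * f x)"
  by (auto simp: lin_iff algebra_simps)

lemma linear_scale_const:
  "vector_space s \<Longrightarrow> lin s0 (*) f \<Longrightarrow> lin s0 s (\<lambda>x. s (f x) v)"
  "vector_space s \<Longrightarrow> lin s0 s g \<Longrightarrow> lin s0 s (\<lambda>x. s c (g x))"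
  by (auto simp: lin_iff vs_simps mult.commute)

lemma linear_bilin_on:
  assumes "bilin_on UNIV UNIV s1 s2 s3 m" "vector_space s1" "vector_space s2" "vector_space s3"
  shows "lin s0 s1 f \<Longrightarrow> lin s0 s3 (\<lambda>x. m (f x) c)" "lin s0 s2 f \<Longrightarrow> lin s0 s3 (\<lambda>x. m c (f x))"
  using assms by (auto simp: lin_iff bilin_on_def)

context
  fixes C :: "('k::field, 'a::ab_group_add, 'm) bialg_scheme"
  assumes C: "coalgebra C"
begin

lemma comul_in_range: "comul C x \<in> range (tclass (scl C) (scl C))"
  using C by (simp add: coalgebra_def linear_to_tensor_def)

lemma coalgebra_vector_space: "vector_space (scl C)"
  using C by (simp add: coalgebra_def)

lemma linear_counit: "lin (scl C) (*) (counit C)"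
  using C by (simp add: coalgebra_def)

lemma sw_comul_eq:
  assumes "\<And>b. lin (scl C) s (\<lambda>a. F a b)" "\<And>a. lin (scl C) s (\<lambda>b. F a b)" "p \<in> comul C x"
  shows "sw s (comul C x) F = lin_ext s (\<lambda>(a, b). F a b) p"
  by (rule sw_eq[OF assms(1,2) comul_in_range assms(3)])

lemma comul_rep: obtains p where "p \<in> comul C x"
proof -
  obtain p where "comul C x = tclass (scl C) (scl C) p" using comul_in_range[of x] by auto
  then show ?thesis using that tclass_refl by metis
qed

lemma linear_sw_comul:
  assumes F: "\<And>b. lin (scl C) s (\<lambda>a. F a b)" "\<And>a. lin (scl C) s (\<lambda>b. F a b)"
  shows "lin (scl C) s (\<lambda>x. sw s (comul C x) F)"
proof -
  have s: "vector_space s" using F(1) by (auto simp: lin_iff)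
  note l = linD[OF linear_lin_ext[OF s]]
  have *: "linear_to_tensor (scl C) (scl C) (scl C) (comul C)"
    using C by (simp add: coalgebra_def)
  show ?thesis
  proof (rule linI[OF coalgebra_vector_space s])
    fix x y
    obtain p q where p: "p \<in> comul C x" and q: "q \<in> comul C y" using comul_rep by metis
    then have "p + q \<in> comul C (x + y)" using * by (simp add: linear_to_tensor_def)
    with p q show "sw s (comul C (x + y)) F = sw s (comul C x) F + sw s (comul C y) F"
      by (simp add: sw_comul_eq[OF F] l)
  next
    fix c x
    obtain p where p: "p \<in> comul C x" using comul_rep by metis
    then have "fscale c p \<in> comul C (scl C c x)" using * by (simp add: linear_to_tensor_def)
    with p show "sw s (comul C (scl C c x)) F = s c (sw s (comul C x) F)"
      by (simp add: sw_comul_eq[OF F] l)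
  qed
qed

lemma linear_sw_comul':
  assumes "\<And>b. lin (scl C) s (\<lambda>a. F a b)" "\<And>a. lin (scl C) s (\<lambda>b. F a b)" "lin s0 (scl C) f"
  shows "lin s0 s (\<lambda>x. sw s (comul C (f x)) F)"
  by (rule linear_comp[OF linear_sw_comul[OF assms(1,2)] assms(3)])

text \<open>The axiom equates two classes of threefold tensors; a trilinear F vanishes on the
  relations between such tensors and can therefore be evaluated on both classes.\<close>

lemma coassoc:
  assumes F: "\<And>v w. lin (scl C) s (\<lambda>u. F u v w)" "\<And>u w. lin (scl C) s (\<lambda>v. F u v w)"
    "\<And>u v. lin (scl C) s (\<lambda>w. F u v w)"
  shows "sw s (comul C x) (\<lambda>a b. sw s (comul C a) (\<lambda>u v. F u v b)) =
    sw s (comul C x) (\<lambda>a b. sw s (comul C b) (\<lambda>u v. F a u v))"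
proof -
  have s: "vector_space s" using F(1) by (auto simp: lin_iff)
  let ?p = "sw fscale (comul C x) (\<lambda>x z. sw fscale (comul C x) (\<lambda>x1 x2. gen (x1, x2, z)))"
  let ?q = "sw fscale (comul C x) (\<lambda>x z. sw fscale (comul C z) (\<lambda>z1 z2. gen (x, z1, z2)))"
  have "tclass3 (scl C) (scl C) (scl C) ?p = tclass3 (scl C) (scl C) (scl C) ?q"
    using C by (simp add: coalgebra_def)
  then have "?p - ?q \<in> tensor_null3 (scl C) (scl C) (scl C)"
    using tclass3_refl[of ?p] by (auto simp: tclass3_def)
  then have "lin_ext s (\<lambda>(x, y, z). F x y z) (?p - ?q) = 0"
    using F by (intro lin_ext_zero_tensor_null3) auto
  then show ?thesis
    by (simp add: linD[OF linear_lin_ext[OF s]] sw_linear_image[OF linear_lin_ext[OF s]]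
        lin_ext_gen[OF s])
qed

lemma counit_left:
  assumes F: "lin (scl C) s F"
  shows "sw s (comul C x) (\<lambda>a b. s (counit C a) (F b)) = F x"
proof -
  have "F x = F (sw (scl C) (comul C x) (\<lambda>x y. scl C (counit C x) y))"
    using C by (simp add: coalgebra_def)
  then show ?thesis by (simp add: sw_linear_image[OF F] linD(2)[OF F])
qed

lemma counit_right:
  assumes F: "lin (scl C) s F"
  shows "sw s (comul C x) (\<lambda>a b. s (counit C b) (F a)) = F x"
proof -
  have "F x = F (sw (scl C) (comul C x) (\<lambda>x y. scl C (counit C y) x))"
    using C by (simp add: coalgebra_def)
  then show ?thesis by (simp add: sw_linear_image[OF F] linD(2)[OF F])
qed

end

section \<open>Convolution of trilinear forms on three coalgebras\<close>

definition conv3 where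
  "conv3 C1 C2 C3 f g x y z =
     sw (*) (comul C1 x) (\<lambda>x1 x2. sw (*) (comul C2 y) (\<lambda>y1 y2. sw (*) (comul C3 z) (\<lambda>z1 z2.
       f x1 y1 z1 * g x2 y2 z2)))"

definition trilin where
  "trilin C1 C2 C3 f \<longleftrightarrow> (\<forall>y z. lin (scl C1) (*) (\<lambda>x. f x y z)) \<and>
     (\<forall>x z. lin (scl C2) (*) (\<lambda>y. f x y z)) \<and> (\<forall>x y. lin (scl C3) (*) (\<lambda>z. f x y z))"

lemma conv3_assoc:
  fixes C1 :: "('k::field, 'a::ab_group_add, 'm1) bialg_scheme"
    and C2 :: "('k::field, 'b::ab_group_add, 'm2) bialg_scheme"
    and C3 :: "('k::field, 'c::ab_group_add, 'm3) bialg_scheme"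
  assumes C: "coalgebra C1" "coalgebra C2" "coalgebra C3"
    and "trilin C1 C2 C3 f" "trilin C1 C2 C3 g" "trilin C1 C2 C3 h"
  shows "conv3 C1 C2 C3 (conv3 C1 C2 C3 f g) h = conv3 C1 C2 C3 f (conv3 C1 C2 C3 g h)"
proof (intro ext)
  fix x y z
  note t = assms(4-6)[unfolded trilin_def]
  have L: "lin (scl C1) (*) (\<lambda>x. f x y z)" "lin (scl C2) (*) (\<lambda>y. f x y z)" "lin (scl C3) (*) (\<lambda>z. f x y z)"
      "lin (scl C1) (*) (\<lambda>x. g x y z)" "lin (scl C2) (*) (\<lambda>y. g x y z)" "lin (scl C3) (*) (\<lambda>z. g x y z)"
      "lin (scl C1) (*) (\<lambda>x. h x y z)" "lin (scl C2) (*) (\<lambda>y. h x y z)" "lin (scl C3) (*) (\<lambda>z. h x y z)" for x y z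
    using t by auto
  note rules = L linear_sw_param linear_mult_const
  \<comment> \<open>The instances are oriented: coproducts of the first factor move outwards and
    those of the third inwards. The two coproducts of each factor become adjacent, and
    coassociativity then applies factor by factor.\<close>
  note swaps = sw_swap[OF vs_field, of "comul C3 z" "comul C1 a" for a] 
    sw_swap[OF vs_field, of "comul C2 y" "comul C1 a" for a] 
    sw_swap[OF vs_field, of "comul C3 z" "comul C2 a" for a] 
  note co = coassoc[OF C(1)] coassoc[OF C(2)] coassoc[OF C(3)]
  have "conv3 C1 C2 C3 (conv3 C1 C2 C3 f g) h x y z = 
     sw (*) (comul C1 x) (\<lambda>a b. sw (*) (comul C1 a) (\<lambda>a1 a2. 
     sw (*) (comul C2 y) (\<lambda>c d. sw (*) (comul C2 c) (\<lambda>c1 c2. 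
     sw (*) (comul C3 z) (\<lambda>e k. sw (*) (comul C3 e) (\<lambda>e1 e2.
       f a1 c1 e1 * g a2 c2 e2 * h b d k))))))"
    unfolding conv3_def sw_mult_right by (simp only: swaps)
  also have "\<dots> = 
     sw (*) (comul C1 x) (\<lambda>a b. sw (*) (comul C1 b) (\<lambda>b1 b2. 
     sw (*) (comul C2 y) (\<lambda>c d. sw (*) (comul C2 d) (\<lambda>d1 d2. 
     sw (*) (comul C3 z) (\<lambda>e k. sw (*) (comul C3 k) (\<lambda>k1 k2.
       f a c e * g b1 d1 k1 * h b2 d2 k2))))))"
    by (simp only: co rules)
  also have "\<dots> = conv3 C1 C2 C3 f (conv3 C1 C2 C3 g h) x y z"
    unfolding conv3_def sw_mult_left by (simp only: swaps mult.assoc)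
  finally show "conv3 C1 C2 C3 (conv3 C1 C2 C3 f g) h x y z = conv3 C1 C2 C3 f (conv3 C1 C2 C3 g h) x y z" .
qed

definition counit3 where
  "counit3 C1 C2 C3 x y z = counit C1 x * (counit C2 y * counit C3 z)"

context
  fixes C1 :: "('k::field, 'a::ab_group_add, 'm1) bialg_scheme"
    and C2 :: "('k::field, 'b::ab_group_add, 'm2) bialg_scheme"
    and C3 :: "('k::field, 'c::ab_group_add, 'm3) bialg_scheme"
  assumes C: "coalgebra C1" "coalgebra C2" "coalgebra C3"
begin

lemma conv3_counit:
  assumes "trilin C1 C2 C3 f"
  shows "conv3 C1 C2 C3 (counit3 C1 C2 C3) f = f" "conv3 C1 C2 C3 f (counit3 C1 C2 C3) = f"
proof -
  note t = assms[unfolded trilin_def]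
  have L: "lin (scl C1) (*) (\<lambda>x. f x y z)" "lin (scl C2) (*) (\<lambda>y. f x y z)" "lin (scl C3) (*) (\<lambda>z. f x y z)" for x y z
    using t by auto
  note swl = sw_mult_left[symmetric]
  have 1: "counit3 C1 C2 C3 x1 y1 z1 * f x2 y2 z2 = counit C1 x1 * (counit C2 y1 * (counit C3 z1 * f x2 y2 z2))"
    "f x2 y2 z2 * counit3 C1 C2 C3 x1 y1 z1 = counit C1 x1 * (counit C2 y1 * (counit C3 z1 * f x2 y2 z2))" for x1 y1 z1 x2 y2 z2
    by (simp_all add: counit3_def)
  show "conv3 C1 C2 C3 (counit3 C1 C2 C3) f = f"
    by (intro ext) (simp only: conv3_def 1 swl counit_left[OF C(1), of "(*)"] counit_left[OF C(2), of "(*)"]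
      counit_left[OF C(3), of "(*)"] L)
  show "conv3 C1 C2 C3 f (counit3 C1 C2 C3) = f"
    by (intro ext) (simp only: conv3_def 1 swl counit_right[OF C(1), of "(*)"] counit_right[OF C(2), of "(*)"]
      counit_right[OF C(3), of "(*)"] L)
qed

text \<open>The usual computation of g*f*g' in two ways. Three factors are taken because the
  invariance properties of a form on A x A also involve an element of H: each is an equality of two
  trilinear forms on A, H and A in some order, and it follows once both are inverse to the same
  form.\<close>

lemma conv3_inverse_unique:
  assumes "trilin C1 C2 C3 f" "trilin C1 C2 C3 g" "trilin C1 C2 C3 g'"
    and "conv3 C1 C2 C3 g f = counit3 C1 C2 C3" "conv3 C1 C2 C3 f g' = counit3 C1 C2 C3"
  shows "g = g'"
proof -
  have "conv3 C1 C2 C3 (conv3 C1 C2 C3 g f) g' = conv3 C1 C2 C3 g (conv3 C1 C2 C3 f g')"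
    by (rule conv3_assoc) (use assms C in auto)
  then show ?thesis by (simp add: assms(4,5) conv3_counit[OF assms(2)] conv3_counit[OF assms(3)])
qed

end

section \<open>Splitting data\<close>

locale splitting =
  fixes H :: "('k::field, 'h::ab_group_add) hopf"
    and A :: "('k, 'a::ab_group_add) bialg"
    and \<pi> :: "'a \<Rightarrow> 'h" and \<sigma> :: "'h \<Rightarrow> 'a"
  assumes hopf: "hopf_algebra H" and split: "splitting_datum A H \<pi> \<sigma>"
begin

abbreviation mulA (infixl "\<cdot>" 70) where "a \<cdot> b \<equiv> mul A a b"
abbreviation mulH (infixl "\<bullet>" 70) where "a \<bullet> b \<equiv> mul H a b"
abbreviation "S \<equiv> antipode H"
abbreviation "DA s x F \<equiv> sw s (comul A x) F"
abbreviation "DH s x F \<equiv> sw s (comul H x) F"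
abbreviation "sA \<equiv> scl A"
abbreviation "sH \<equiv> scl H"
abbreviation "\<tau> \<equiv> tau_map A H \<pi> \<sigma>"
abbreviation "R \<equiv> coinvariants A H \<pi>"

lemma bialg: "bialgebra A" "bialgebra H"
  using hopf split by (auto simp: hopf_algebra_def splitting_datum_def)

lemma coalg: "coalgebra A" "coalgebra H" and alg: "unital_algebra A" "unital_algebra H"
  using bialg by (auto simp: bialgebra_def)

lemma vs: "vector_space sA" "vector_space sH"
  using coalg by (auto simp: coalgebra_def)

lemma bilin_mul: "bilin_on UNIV UNIV sA sA sA (mul A)" "bilin_on UNIV UNIV sH sH sH (mul H)"
  using alg by (auto simp: unital_algebra_def)

lemma assoc: "a \<cdot> b \<cdot> c = a \<cdot> (b \<cdot> c)" "h \<bullet> k \<bullet> l = h \<bullet> (k \<bullet> l)"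
  using alg by (auto simp: unital_algebra_def)

lemma unit [simp]: "a \<cdot> unity A = a" "unity A \<cdot> a = a" "h \<bullet> unity H = h" "unity H \<bullet> h = h"
  using alg by (auto simp: unital_algebra_def)

lemma linear_maps: "lin sH sA \<sigma>" "lin sA sH \<pi>" "lin sH sH S"
  using hopf split by (auto simp: hopf_algebra_def splitting_datum_def bialgebra_hom_def coalgebra_hom_def)

lemma sigma: "\<sigma> (h \<bullet> k) = \<sigma> h \<cdot> \<sigma> k" "\<sigma> (unity H) = unity A" "counit A (\<sigma> h) = counit H h"
  using split by (auto simp: splitting_datum_def bialgebra_hom_def coalgebra_hom_def)

lemma pi_sigma [simp]: "\<pi> (\<sigma> h) = h"
  using split by (auto simp: splitting_datum_def)

lemma counit_pi: "counit H (\<pi> a) = counit A a"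
  using split by (auto simp: splitting_datum_def coalgebra_hom_def)

lemma pi_bimodule: "\<pi> (\<sigma> h \<cdot> x) = h \<bullet> \<pi> x" "\<pi> (x \<cdot> \<sigma> h) = \<pi> x \<bullet> h"
proof -
  have *: "\<pi> (\<sigma> h \<cdot> x \<cdot> \<sigma> h') = h \<bullet> \<pi> x \<bullet> h'" for h x h'
    using split by (auto simp: splitting_datum_def)
  show "\<pi> (\<sigma> h \<cdot> x) = h \<bullet> \<pi> x" using *[of h x "unity H"] by (simp add: sigma)
  show "\<pi> (x \<cdot> \<sigma> h) = \<pi> x \<bullet> h" using *[of "unity H" x h] by (simp add: sigma)
qed

lemma counit_mul: "counit A (a \<cdot> b) = counit A a * counit A b" "counit H (h \<bullet> k) = counit H h * counit H k"
  "counit A (unity A) = 1" "counit H (unity H) = 1"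
  using bialg by (auto simp: bialgebra_def)

text \<open>A structural calculus for linearity: used as rewrite rules, these reduce the side
  condition of a Sweedler step to linearity of the basic maps.\<close>

lemmas lins =
  linear_sw_param linear_mult_const
  linear_scale_const[OF vs(1)] linear_scale_const[OF vs(2)]
  linear_bilin_on[OF bilin_mul(1) vs(1) vs(1) vs(1)]
  linear_bilin_on[OF bilin_mul(2) vs(2) vs(2) vs(2)]
  linear_comp[OF linear_maps(1)] linear_comp[OF linear_maps(2)] linear_comp[OF linear_maps(3)]
  linear_comp[OF linear_counit[OF coalg(1)]] linear_comp[OF linear_counit[OF coalg(2)]]
  linear_ident[OF vs(1)] linear_ident[OF vs(2)] linear_ident[OF vs_field]
  linear_sw_comul'[OF coalg(1)] linear_sw_comul'[OF coalg(2)] 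

lemmas coas = coassoc[OF coalg(1)] coassoc[OF coalg(2)]

lemma DH_pi:
  assumes "\<And>k. lin sH s (\<lambda>h. F h k)" "\<And>h. lin sH s (\<lambda>k. F h k)"
  shows "DH s (\<pi> a) F = DA s a (\<lambda>a1 a2. F (\<pi> a1) (\<pi> a2))"
proof -
  have "comul H (\<pi> a) = tmap sH sH \<pi> \<pi> (comul A a)"
    using split by (auto simp: splitting_datum_def coalgebra_hom_def)
  then show ?thesis by (simp only: sw_tmap[OF assms])
qed

lemma DA_sigma:
  assumes "\<And>k. lin sA s (\<lambda>h. F h k)" "\<And>h. lin sA s (\<lambda>k. F h k)"
  shows "DA s (\<sigma> a) F = DH s a (\<lambda>a1 a2. F (\<sigma> a1) (\<sigma> a2))"
proof -
  have "comul A (\<sigma> a) = tmap sA sA \<sigma> \<sigma> (comul H a)"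
    using split by (auto simp: splitting_datum_def bialgebra_hom_def coalgebra_hom_def)
  then show ?thesis by (simp only: sw_tmap[OF assms])
qed

lemma DA_mul:
  assumes "\<And>k. lin sA s (\<lambda>h. F h k)" "\<And>h. lin sA s (\<lambda>k. F h k)"
  shows "DA s (a \<cdot> b) F = DA s a (\<lambda>a1 a2. DA s b (\<lambda>b1 b2. F (a1 \<cdot> b1) (a2 \<cdot> b2)))"
proof -
  have s: "vector_space s" using assms(1) by (auto simp: lin_iff)
  have "comul A (a \<cdot> b) = tclass sA sA (sw fscale (comul A a) (\<lambda>a1 a2. sw fscale (comul A b) (\<lambda>b1 b2.
             gen (a1 \<cdot> b1, a2 \<cdot> b2))))"
    using bialg by (simp add: bialgebra_def)
  then show ?thesis
    by (simp add: sw_tclass[OF assms] sw_linear_image[OF linear_lin_ext[OF s]] lin_ext_gen[OF s])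
qed

lemma DH_mul:
  assumes "\<And>k. lin sH s (\<lambda>h. F h k)" "\<And>h. lin sH s (\<lambda>k. F h k)"
  shows "DH s (a \<bullet> b) F = DH s a (\<lambda>a1 a2. DH s b (\<lambda>b1 b2. F (a1 \<bullet> b1) (a2 \<bullet> b2)))"
proof -
  have s: "vector_space s" using assms(1) by (auto simp: lin_iff)
  have "comul H (a \<bullet> b) = tclass sH sH (sw fscale (comul H a) (\<lambda>a1 a2. sw fscale (comul H b) (\<lambda>b1 b2.
             gen (a1 \<bullet> b1, a2 \<bullet> b2))))"
    using bialg by (simp add: bialgebra_def)
  then show ?thesis
    by (simp add: sw_tclass[OF assms] sw_linear_image[OF linear_lin_ext[OF s]] lin_ext_gen[OF s])
qed

lemma DA_unity:
  assumes "\<And>k. lin sA s (\<lambda>h. F h k)" "\<And>h. lin sA s (\<lambda>k. F h k)"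
  shows "DA s (unity A) F = F (unity A) (unity A)"
proof -
  have "comul A (unity A) = pure_tensor sA sA (unity A) (unity A)"
    using bialg by (simp add: bialgebra_def)
  then show ?thesis by (simp add: sw_pure_tensor[OF assms])
qed

lemma DH_unity:
  assumes "\<And>k. lin sH s (\<lambda>h. F h k)" "\<And>h. lin sH s (\<lambda>k. F h k)"
  shows "DH s (unity H) F = F (unity H) (unity H)"
proof -
  have "comul H (unity H) = pure_tensor sH sH (unity H) (unity H)"
    using bialg by (simp add: bialgebra_def)
  then show ?thesis by (simp add: sw_pure_tensor[OF assms])
qed

lemma antipode:
  assumes "lin sH s F"
  shows "DH s h (\<lambda>u v. F (S u \<bullet> v)) = s (counit H h) (F (unity H))"
    "DH s h (\<lambda>u v. F (u \<bullet> S v)) = s (counit H h) (F (unity H))"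
proof -
  have "DH s h (\<lambda>u v. F (S u \<bullet> v)) = F (DH sH h (\<lambda>u v. S u \<bullet> v))"
    "DH s h (\<lambda>u v. F (u \<bullet> S v)) = F (DH sH h (\<lambda>u v. u \<bullet> S v))"
    by (simp_all add: sw_linear_image[OF assms])
  then show "DH s h (\<lambda>u v. F (S u \<bullet> v)) = s (counit H h) (F (unity H))"
    "DH s h (\<lambda>u v. F (u \<bullet> S v)) = s (counit H h) (F (unity H))"
    using hopf by (simp_all add: hopf_algebra_def linD(2)[OF assms])
qed

lemma antipode_unity [simp]: "S (unity H) = unity H"
proof -
  have "DH sH (unity H) (\<lambda>u v. S u \<bullet> v) = S (unity H) \<bullet> unity H"
    by (rule DH_unity) (simp_all only: lins)
  then show ?thesis using antipode(1)[OF linear_ident[OF vs(2)], of "unity H"]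
    by (simp add: counit_mul vs_simps(4)[OF vs(2)])
qed

text \<open>This consequence of the anti-comultiplicativity of \<open>S\<close> can be had without it: insert
  \<open>S(h\<^sub>1)h\<^sub>2\<close> and collect \<open>\<Delta>(h\<^sub>2 S(h\<^sub>3))\<close>.\<close>

lemma antipode_comul:
  assumes F: "\<And>k. lin sH s (\<lambda>h. F h k)" "\<And>h. lin sH s (\<lambda>k. F h k)"
  shows "DH s h (\<lambda>h1 h2. DH s (S h2) (\<lambda>u v. F u (h1 \<bullet> v))) = F (S h) (unity H)"
proof -
  have s: "vector_space s" using assms(1) by (auto simp: lin_iff)
  note L = lins linear_comp[OF F(1)] linear_comp[OF F(2)] linear_scale_const[OF s]
  have "DH s h (\<lambda>h1 h2. DH s (S h2) (\<lambda>u v. F u (h1 \<bullet> v))) =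
    DH s h (\<lambda>a b. s (counit H a) (DH s b (\<lambda>h1 h2. DH s (S h2) (\<lambda>u v. F u (h1 \<bullet> v)))))"
    by (rule counit_left[OF coalg(2), symmetric]) (simp only: L)
  also have "\<dots> = DH s h (\<lambda>a b. DH s a (\<lambda>c d. DH s b (\<lambda>h1 h2. DH s (S h2) (\<lambda>u v. F (S c \<bullet> d \<bullet> u) (h1 \<bullet> v)))))"
  proof -
    have "s (counit H a) (DH s b (\<lambda>h1 h2. DH s (S h2) (\<lambda>u v. F u (h1 \<bullet> v)))) =
      DH s a (\<lambda>c d. DH s b (\<lambda>h1 h2. DH s (S h2) (\<lambda>u v. F (S c \<bullet> d \<bullet> u) (h1 \<bullet> v))))" for a b
      using antipode(1)[of s "\<lambda>w. DH s b (\<lambda>h1 h2. DH s (S h2) (\<lambda>u v. F (w \<bullet> u) (h1 \<bullet> v)))" a]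
      by (simp only: L unit)
    then show ?thesis by simp
  qed
  also have "\<dots> = DH s h (\<lambda>c b. DH s b (\<lambda>d e. DH s e (\<lambda>h1 h2. DH s (S h2) (\<lambda>u v. F (S c \<bullet> d \<bullet> u) (h1 \<bullet> v)))))"
    by (simp only: L coas)
  also have "\<dots> = DH s h (\<lambda>c b. DH s b (\<lambda>e h2. DH s e (\<lambda>d h1. DH s (S h2) (\<lambda>u v. F (S c \<bullet> (d \<bullet> u)) (h1 \<bullet> v)))))"
    by (simp only: L coas assoc)
  also have "\<dots> = DH s h (\<lambda>c b. DH s b (\<lambda>e h2. DH s (e \<bullet> S h2) (\<lambda>u v. F (S c \<bullet> u) v)))"
    by (simp only: L DH_mul)
  also have "\<dots> = DH s h (\<lambda>c b. s (counit H b) (F (S c) (unity H)))"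
    by (subst antipode(2)[of s "\<lambda>w. DH s w (\<lambda>u v. F (S _ \<bullet> u) v)"])
     (simp_all only: L DH_unity unit)
  also have "\<dots> = F (S h) (unity H)"
    by (rule counit_right[OF coalg(2), of s "\<lambda>c. F (S c) (unity H)"]) (simp only: L)
  finally show ?thesis .
qed

section \<open>Coinvariants and the projection \<tau>\<close>

lemma coinvariantD:
  assumes "x \<in> R"
    and F: "\<And>h. lin sA s (\<lambda>u. F u h)" "\<And>u. lin sH s (\<lambda>h. F u h)"
  shows "DA s x (\<lambda>u v. F u (\<pi> v)) = F x (unity H)"
proof -
  have "DA s x (\<lambda>u v. F u (\<pi> v)) = sw s (tmap sA sH id \<pi> (comul A x)) F"
    by (simp add: sw_tmap[OF F])
  also have "\<dots> = F x (unity H)"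
    using assms(1) by (simp add: coinvariants_def sw_pure_tensor[OF F])
  finally show ?thesis .
qed

text \<open>Membership in R is an equality of tensors, so by \<open>tensor_eqI\<close> scalar-valued
  test maps suffice.\<close>

lemma coinvariantI:
  assumes "\<And>F. (\<And>h. lin sA (*) (\<lambda>u. F u h)) \<Longrightarrow> (\<And>u. lin sH (*) (\<lambda>h. F u h)) \<Longrightarrow>
      DA (*) x (\<lambda>u v. F u (\<pi> v)) = F x (unity H)"
  shows "x \<in> R"
proof -
  have "tclass sA sH (sw fscale (comul A x) (\<lambda>u v. gen (id u, \<pi> v))) = tclass sA sH (gen (x, unity H))"
    by (rule tensor_eqI[OF vs])
     (simp add: assms lin_ext_gen[OF vs_field] sw_linear_image[OF linear_lin_ext[OF vs_field]])
  then show ?thesis by (simp add: coinvariants_def tmap_def pure_tensor_def)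
qed

lemma linear_tau: "lin sA sA \<tau>"
  unfolding tau_map_def[abs_def] by (simp only: lins)

lemma linear_image_tau:
  assumes "lin sA s f"
  shows "f (\<tau> a) = DA s a (\<lambda>a1 a2. f (a1 \<cdot> \<sigma> (S (\<pi> a2))))"
  unfolding tau_map_def by (rule sw_linear_image[OF assms])

text \<open>Expanding the coproduct of a1 \<sigma>(S(\<pi>(a2))) and applying \<pi> to the right leg
  leaves a product of \<pi>(a2) with a leg of the coproduct of S(\<pi>(a3));
  \<open>antipode_comul\<close> with h = \<pi>(a2) collapses it to 1, after a2 and a3 have been
  merged.\<close>

lemma tau_mem: "\<tau> a \<in> R"
proof (rule coinvariantI)
  fix F :: "'a \<Rightarrow> 'h \<Rightarrow> 'k"
  assume F: "\<And>h. lin sA (*) (\<lambda>u. F u h)" "\<And>u. lin sH (*) (\<lambda>h. F u h)"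
  note L = lins linear_comp[OF F(1)] linear_comp[OF F(2)]
  have "DA (*) (\<tau> a) (\<lambda>u v. F u (\<pi> v)) =
      DA (*) a (\<lambda>a1 a2. DA (*) (a1 \<cdot> \<sigma> (S (\<pi> a2))) (\<lambda>u v. F u (\<pi> v)))"
    by (rule linear_image_tau) (simp only: L)
  also have "\<dots> = DA (*) a (\<lambda>a1 a2. DA (*) a1 (\<lambda>b1 b2. DH (*) (S (\<pi> a2)) (\<lambda>u v. F (b1 \<cdot> \<sigma> u) (\<pi> b2 \<bullet> v))))"
    by (simp only: L DA_mul DA_sigma pi_bimodule)
  also have "\<dots> = DA (*) a (\<lambda>b a2. DA (*) a2 (\<lambda>c d. DH (*) (S (\<pi> d)) (\<lambda>u v. F (b \<cdot> \<sigma> u) (\<pi> c \<bullet> v))))"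
    by (simp only: L coas)
  also have "\<dots> = DA (*) a (\<lambda>b a2. DH (*) (\<pi> a2) (\<lambda>h1 h2. DH (*) (S h2) (\<lambda>u v. F (b \<cdot> \<sigma> u) (h1 \<bullet> v))))"
    by (simp only: L DH_pi)
  also have "\<dots> = DA (*) a (\<lambda>b a2. F (b \<cdot> \<sigma> (S (\<pi> a2))) (unity H))"
    by (subst antipode_comul[of "(*)" "\<lambda>u w. F (_ \<cdot> \<sigma> u) w"]) (simp_all only: L)
  also have "\<dots> = F (\<tau> a) (unity H)"
    by (rule linear_image_tau[symmetric]) (simp only: L F)
  finally show "DA (*) (\<tau> a) (\<lambda>u v. F u (\<pi> v)) = F (\<tau> a) (unity H)" .
qed

lemma tau_of_coinvariant: "x \<in> R \<Longrightarrow> \<tau> x = x"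
  unfolding tau_map_def
  by (subst coinvariantD[of x sA "\<lambda>u h. u \<cdot> \<sigma> (S h)"]) (simp_all only: lins antipode_unity sigma unit)

text \<open>R is the fixed space of the linear map \<tau>; this is how its closure under sums and
  scalars is obtained.\<close>

lemma coinvariant_iff: "x \<in> R \<longleftrightarrow> \<tau> x = x"
  using tau_of_coinvariant tau_mem by metis

text \<open>The coproduct of a coinvariant lies in A \<otimes> R: writing \<tau>(x2) as x2
  \<sigma>(S(\<pi>(x3))), coinvariance of x replaces \<pi>(x3) by 1.\<close>

lemma coinvariant_comul:
  assumes "x \<in> R" and F: "\<And>v. lin sA s (\<lambda>u. F u v)" "\<And>u. lin sA s (\<lambda>v. F u v)"
  shows "DA s x (\<lambda>u v. F u (\<tau> v)) = DA s x F"
proof -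
  note L = lins linear_comp[OF F(1)] linear_comp[OF F(2)] linear_comp[OF linear_tau]
  have "DA s x (\<lambda>u v. F u (\<tau> v)) = DA s x (\<lambda>u w. DA s w (\<lambda>v b. F u (v \<cdot> \<sigma> (S (\<pi> b)))))"
    by (subst linear_image_tau[of s "F _"]) (simp_all only: F)
  also have "\<dots> = DA s x (\<lambda>a b. DA s a (\<lambda>u v. F u (v \<cdot> \<sigma> (S (\<pi> b)))))"
    by (simp only: L coas)
  also have "\<dots> = DA s x F"
    by (subst coinvariantD[OF assms(1), of s "\<lambda>a h. DA s a (\<lambda>u v. F u (v \<cdot> \<sigma> (S h)))"])
      (simp_all only: L F antipode_unity sigma unit)
  finally show ?thesis .
qed

text \<open>The left side is x1 \<sigma>(S(\<pi>(x2)) \<pi>(x3)) under f. Since \<pi> is a coalgebra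
  map, the antipode axiom for \<pi>(x2) turns the \<sigma>-factor into a counit.\<close>

lemma tau_sigma_pi:
  assumes f: "lin sA s f"
  shows "DA s x (\<lambda>u v. f (\<tau> u \<cdot> \<sigma> (\<pi> v))) = f x"
proof -
  have s: "vector_space s" using f by (auto simp: lin_iff)
  note L = lins linear_comp[OF f] linear_scale_const[OF s]
  have "DA s x (\<lambda>u v. f (\<tau> u \<cdot> \<sigma> (\<pi> v))) = DA s x (\<lambda>u v. DA s u (\<lambda>p q. f (p \<cdot> \<sigma> (S (\<pi> q)) \<cdot> \<sigma> (\<pi> v))))"
    by (subst linear_image_tau[of s "\<lambda>w. f (w \<cdot> _)"]) (simp_all only: L)
  also have "\<dots> = DA s x (\<lambda>p w. DA s w (\<lambda>q v. f (p \<cdot> \<sigma> (S (\<pi> q) \<bullet> \<pi> v))))"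
    by (simp only: L coas assoc sigma)
  also have "\<dots> = DA s x (\<lambda>p w. DH s (\<pi> w) (\<lambda>q v. f (p \<cdot> \<sigma> (S q \<bullet> v))))"
    by (simp only: L DH_pi)
  also have "\<dots> = DA s x (\<lambda>p w. s (counit A w) (f p))"
    by (subst antipode(1)[of s "\<lambda>t. f (_ \<cdot> \<sigma> t)"]) (simp_all only: L counit_pi sigma unit)
  also have "\<dots> = f x"
    by (rule counit_right[OF coalg(1) f])
  finally show ?thesis .
qed

text \<open>Insert S(g1) g2 on the left. Then g2 h1 S(g3 h2) is the antipode expression for the
  single element g2 h, hence a counit, and only S(g1) survives.\<close>

lemma antipode_cancel:
  assumes f: "lin sH s f"
  shows "DH s h (\<lambda>h1 h2. f (h1 \<bullet> S (g \<bullet> h2))) = s (counit H h) (f (S g))"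
proof -
  have s: "vector_space s" using f by (auto simp: lin_iff)
  note L = lins linear_comp[OF f] linear_scale_const[OF s]
  have "DH s h (\<lambda>h1 h2. f (h1 \<bullet> S (g \<bullet> h2))) =
     DH s g (\<lambda>a b. s (counit H a) (DH s h (\<lambda>h1 h2. f (h1 \<bullet> S (b \<bullet> h2)))))"
    by (rule counit_left[OF coalg(2), symmetric]) (simp only: L)
  also have "\<dots> = DH s g (\<lambda>a b. DH s a (\<lambda>p q. DH s h (\<lambda>h1 h2. f (S p \<bullet> q \<bullet> (h1 \<bullet> S (b \<bullet> h2))))))"
    by (subst antipode(1)[of s "\<lambda>t. DH s h (\<lambda>h1 h2. f (t \<bullet> (h1 \<bullet> S (_ \<bullet> h2))))"])
      (simp_all only: L unit)
  also have "\<dots> = DH s g (\<lambda>p w. DH s w (\<lambda>q b. DH s h (\<lambda>h1 h2. f (S p \<bullet> ((q \<bullet> h1) \<bullet> S (b \<bullet> h2))))))"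
    by (simp only: L coas assoc)
  also have "\<dots> = DH s g (\<lambda>p w. DH s (w \<bullet> h) (\<lambda>u v. f (S p \<bullet> (u \<bullet> S v))))"
    by (simp only: L DH_mul)
  also have "\<dots> = DH s g (\<lambda>p w. s (counit H w) (s (counit H h) (f (S p))))"
    by (subst antipode(2)[of s "\<lambda>t. f (_ \<bullet> t)"])
      (simp_all only: L unit counit_mul vs_simps(3)[OF s])
  also have "\<dots> = s (counit H h) (f (S g))"
    by (rule counit_right[OF coalg(2), of s "\<lambda>c. s (counit H h) (f (S c))"]) (simp only: L)
  finally show ?thesis .
qed

text \<open>The product is a1 \<sigma>(h1 S(\<pi>(a2) h2)), which is \<open>antipode_cancel\<close>
  with g = \<pi>(a2). This is what makes forms composed with \<tau> invariant under \<sigma>(H) on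
  the right.\<close>

lemma tau_mul_sigma: "\<tau> (a \<cdot> \<sigma> h) = sA (counit H h) (\<tau> a)"
proof -
  have "\<tau> (a \<cdot> \<sigma> h) = DA sA a (\<lambda>a1 a2. DH sA h (\<lambda>h1 h2. a1 \<cdot> \<sigma> (h1 \<bullet> S (\<pi> a2 \<bullet> h2))))"
    unfolding tau_map_def by (simp only: lins DA_mul DA_sigma pi_bimodule assoc sigma)
  also have "\<dots> = DA sA a (\<lambda>a1 a2. sA (counit H h) (a1 \<cdot> \<sigma> (S (\<pi> a2))))"
    by (subst antipode_cancel[of sA "\<lambda>t. _ \<cdot> \<sigma> t"]) (simp_all only: lins)
  also have "\<dots> = sA (counit H h) (\<tau> a)"
    unfolding tau_map_def by (simp only: sw_scale[OF vs(1)])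
  finally show ?thesis .
qed

text \<open>In \<tau>(\<sigma>(h) r) the antipode is applied to h2 \<pi>(r2), and coinvariance of r
  replaces \<pi>(r2) by 1. The new formula shows that the action stays in R and is linear on all of
  A.\<close>

lemma adjoint_action:
  assumes "r \<in> R"
  shows "DH sA h (\<lambda>h1 h2. \<sigma> h1 \<cdot> r \<cdot> \<sigma> (S h2)) = \<tau> (\<sigma> h \<cdot> r)"
proof -
  have "\<tau> (\<sigma> h \<cdot> r) = DH sA h (\<lambda>h1 h2. DA sA r (\<lambda>r1 r2. \<sigma> h1 \<cdot> r1 \<cdot> \<sigma> (S (h2 \<bullet> \<pi> r2))))"
    unfolding tau_map_def by (simp only: lins DA_mul DA_sigma pi_bimodule)
  also have "\<dots> = DH sA h (\<lambda>h1 h2. \<sigma> h1 \<cdot> r \<cdot> \<sigma> (S h2))"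
    by (subst coinvariantD[OF assms, of sA "\<lambda>u t. \<sigma> _ \<cdot> u \<cdot> \<sigma> (S (_ \<bullet> t))"]) (simp_all only: lins unit)
  finally show ?thesis by simp
qed

lemma coinvariant_closed:
  "x \<in> R \<Longrightarrow> y \<in> R \<Longrightarrow> x + y \<in> R" "x \<in> R \<Longrightarrow> sA c x \<in> R"
  by (simp_all add: coinvariant_iff linD[OF linear_tau])

section \<open>The braided comultiplication\<close>

abbreviation "RA \<equiv> associated_R A H \<pi> \<sigma>"

lemma RA_simps:
  "car RA = R" "scl RA = sA" "unity RA = unity A"
  "x \<in> R \<Longrightarrow> comul RA x = tmap sA sA \<tau> id (comul A x)"
  "x \<in> R \<Longrightarrow> coact RA x = tmap sH sA \<pi> id (comul A x)"
  "x \<in> R \<Longrightarrow> act RA h x = \<tau> (\<sigma> h \<cdot> x)"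
  "x \<in> R \<Longrightarrow> y \<in> R \<Longrightarrow> mul RA x y = \<tau> (x \<cdot> y)"
  "x \<in> R \<Longrightarrow> counit RA x = counit A x"
  by (simp_all add: associated_R_def Let_def restrict2_def adjoint_action)

text \<open>With \<tau> on the right leg too, the comultiplication and the coaction of R have
  representatives whose right components lie in R, as \<open>sw_on_subspace\<close> demands.\<close>

lemma tmap_tau_coinvariant:
  assumes "x \<in> R" and vs': "vector_space s1" and f: "lin sA s1 f"
  shows "tmap s1 sA f id (comul A x) = tmap s1 sA f \<tau> (comul A x)"
  unfolding tmap_def
proof (rule tensor_eqI[OF vs' vs(1)])
  fix F :: "'b \<Rightarrow> 'a \<Rightarrow> 'k"
  assume F: "\<And>y. lin s1 (*) (\<lambda>x. F x y)" "\<And>x. lin sA (*) (\<lambda>y. F x y)"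
  have "DA (*) x (\<lambda>u v. F (f u) (\<tau> v)) = DA (*) x (\<lambda>u v. F (f u) v)"
    by (rule coinvariant_comul[OF assms(1), of "(*)" "\<lambda>u v. F (f u) v"])
      (simp_all only: F linear_comp[OF F(1)] f)
  then show "lin_ext (*) (\<lambda>(x, y). F x y) (sw fscale (comul A x) (\<lambda>x y. gen (f x, id y))) =
    lin_ext (*) (\<lambda>(x, y). F x y) (sw fscale (comul A x) (\<lambda>x y. gen (f x, \<tau> y)))"
    by (simp add: sw_linear_image[OF linear_lin_ext[OF vs_field]] lin_ext_gen[OF vs_field])
qed

lemma sw_comul_R:
  assumes "x \<in> R" and G: "\<And>v. lin sA s (\<lambda>u. G u v)" "\<And>u. lin sA s (\<lambda>v. G u v)"
    and "\<And>u v. u \<in> R \<Longrightarrow> v \<in> R \<Longrightarrow> F u v = G u v"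
  shows "sw_on R R s (comul RA x) F = DA s x (\<lambda>u v. G (\<tau> u) v)"
proof -
  have eq: "comul RA x = tmap sA sA \<tau> \<tau> (comul A x)"
    using tmap_tau_coinvariant[OF assms(1) vs(1) linear_tau] by (simp add: RA_simps assms(1))
  obtain p where p: "p \<in> comul RA x" "Poly_Mapping.keys p \<subseteq> R \<times> R"
    unfolding eq using tmap_keys[of sA sA \<tau> \<tau> "comul A x"] tau_mem by blast
  have "sw_on R R s (comul RA x) F = sw s (comul RA x) G"
    by (rule sw_on_subspace[OF G _ p assms(4)]) (auto simp: eq tmap_in_range)
  also have "\<dots> = DA s x (\<lambda>u v. G (\<tau> u) v)"
    by (simp add: RA_simps assms(1) sw_tmap[OF G])
  finally show ?thesis .
qed

lemma sw_coact_R: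
  assumes "x \<in> R" and G: "\<And>v. lin sH s (\<lambda>u. G u v)" "\<And>u. lin sA s (\<lambda>v. G u v)"
    and "\<And>u v. v \<in> R \<Longrightarrow> F u v = G u v"
  shows "sw_on UNIV R s (coact RA x) F = DA s x (\<lambda>u v. G (\<pi> u) v)"
proof -
  have eq: "coact RA x = tmap sH sA \<pi> \<tau> (comul A x)"
    using tmap_tau_coinvariant[OF assms(1) vs(2) linear_maps(2)] by (simp add: RA_simps assms(1))
  obtain p where p: "p \<in> coact RA x" "Poly_Mapping.keys p \<subseteq> UNIV \<times> R"
    unfolding eq using tmap_keys[of sH sA \<pi> \<tau> "comul A x"] tau_mem by blast
  have "sw_on UNIV R s (coact RA x) F = sw s (coact RA x) G"
    by (rule sw_on_subspace[OF G _ p assms(4)]) (auto simp: eq tmap_in_range)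
  also have "\<dots> = DA s x (\<lambda>u v. G (\<pi> u) v)"
    by (simp add: RA_simps assms(1) sw_tmap[OF G])
  finally show ?thesis .
qed

text \<open>Here \<Phi> may contain maps restricted to R and \<Psi> is a total 4-linear substitute.
  Since \<tau> has its values in R, only arguments at which both agree are ever fed to
  \<Phi>.\<close>

lemma sw_RR_eq:
  assumes "x \<in> R" "y \<in> R"
    and P: "\<And>b c d. lin sA s (\<lambda>a. \<Psi> a b c d)" "\<And>a c d. lin sA s (\<lambda>b. \<Psi> a b c d)"
      "\<And>a b d. lin sA s (\<lambda>c. \<Psi> a b c d)" "\<And>a b c. lin sA s (\<lambda>d. \<Psi> a b c d)"
    and eq: "\<And>a b c d. a \<in> R \<Longrightarrow> b \<in> R \<Longrightarrow> c \<in> R \<Longrightarrow> d \<in> R \<Longrightarrow> \<Phi> a b c d = \<Psi> a b c d"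
  shows "sw_RR RA s x y \<Phi> = DA s x (\<lambda>u v. DA s v (\<lambda>p q. DA s y (\<lambda>b d. \<Psi> (\<tau> u) (\<tau> (\<sigma> (\<pi> p) \<cdot> \<tau> b)) q d)))"
proof -
  note L = lins P linear_comp[OF P(1)] linear_comp[OF P(2)] linear_comp[OF P(3)] linear_comp[OF P(4)]
    linear_comp[OF linear_tau]
  have 1: "sw_on R R s (comul RA y) (\<lambda>y1 y2. \<Phi> x1 (act RA h y1) x20 y2) =
    DA s y (\<lambda>b d. \<Psi> x1 (\<tau> (\<sigma> h \<cdot> \<tau> b)) x20 d)" if "x1 \<in> R" "x20 \<in> R" for x1 x20 h
    by (rule sw_comul_R[OF assms(2), where G = "\<lambda>b d. \<Psi> x1 (\<tau> (\<sigma> h \<cdot> b)) x20 d"])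
      (simp_all only: L eq that RA_simps tau_mem)
  have 2: "sw_on UNIV R s (coact RA x2) (\<lambda>h x20.
     sw_on R R s (comul RA y) (\<lambda>y1 y2. \<Phi> x1 (act RA h y1) x20 y2)) =
    DA s x2 (\<lambda>p q. DA s y (\<lambda>b d. \<Psi> x1 (\<tau> (\<sigma> (\<pi> p) \<cdot> \<tau> b)) q d))" if "x1 \<in> R" "x2 \<in> R" for x1 x2
    by (rule sw_coact_R[OF that(2), where G = "\<lambda>h q. DA s y (\<lambda>b d. \<Psi> x1 (\<tau> (\<sigma> h \<cdot> \<tau> b)) q d)"])
      (simp_all only: L 1 that)
  show ?thesis
    unfolding sw_RR_def RA_simps
    by (rule sw_comul_R[OF assms(1), where G = "\<lambda>u v. DA s v (\<lambda>p q. DA s y (\<lambda>b d. \<Psi> u (\<tau> (\<sigma> (\<pi> p) \<cdot> \<tau> b)) q d))"])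
      (simp_all only: L 2)
qed

text \<open>The factor \<open>\<sigma>(\<pi>(x\<^sub>2))\<close> of the adjoint action moves to the first argument, where it restores
  \<open>x\<^sub>1\<close> from \<open>\<tau>(x\<^sub>1)\<close>.\<close>

lemma sw_RR_balanced:
  assumes xy: "x \<in> R" "y \<in> R"
    and P: "\<And>b c d. lin sA s (\<lambda>a. \<Psi> a b c d)" "\<And>a c d. lin sA s (\<lambda>b. \<Psi> a b c d)"
      "\<And>a b d. lin sA s (\<lambda>c. \<Psi> a b c d)" "\<And>a b c. lin sA s (\<lambda>d. \<Psi> a b c d)"
    and eq: "\<And>a b c d. a \<in> R \<Longrightarrow> b \<in> R \<Longrightarrow> c \<in> R \<Longrightarrow> d \<in> R \<Longrightarrow> \<Phi> a b c d = \<Psi> a b c d"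
    and bal: "\<And>a h b c d. \<Psi> (a \<cdot> \<sigma> h) b c d = \<Psi> a (\<sigma> h \<cdot> b) c d"
  shows "sw_RR RA s x y \<Phi> = DA s x (\<lambda>a w. DA s w (\<lambda>p q. DA s y (\<lambda>b d. DA s d (\<lambda>c e.
      \<Psi> a (b \<cdot> \<sigma> (S (\<pi> c)) \<cdot> \<sigma> (S (\<pi> p))) q e))))"
proof -
  note L = lins P linear_comp[OF P(1)] linear_comp[OF P(2)] linear_comp[OF P(3)] linear_comp[OF P(4)]
    linear_comp[OF linear_tau]
  have *: "\<Psi> a (\<tau> (\<sigma> (\<pi> p) \<cdot> \<tau> b)) q d = DA s p (\<lambda>p1 p2. \<Psi> (a \<cdot> \<sigma> (\<pi> p1)) (\<tau> b \<cdot> \<sigma> (S (\<pi> p2))) q d)" for a p b q d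
  proof -
    have "\<Psi> a (\<tau> (\<sigma> (\<pi> p) \<cdot> \<tau> b)) q d = DH s (\<pi> p) (\<lambda>h1 h2. \<Psi> a (\<sigma> h1 \<cdot> \<tau> b \<cdot> \<sigma> (S h2)) q d)"
      unfolding adjoint_action[OF tau_mem, symmetric] by (rule sw_linear_image[OF P(2)])
    also have "\<dots> = DA s p (\<lambda>p1 p2. \<Psi> (a \<cdot> \<sigma> (\<pi> p1)) (\<tau> b \<cdot> \<sigma> (S (\<pi> p2))) q d)"
      by (simp only: L DH_pi bal assoc)
    finally show ?thesis .
  qed
  have **: "DA s y (\<lambda>b d. \<Psi> a (\<tau> b \<cdot> t) q d) = DA s y (\<lambda>b d. DA s d (\<lambda>c e. \<Psi> a (b \<cdot> \<sigma> (S (\<pi> c)) \<cdot> t) q e))" for a t q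
  proof -
    have "DA s y (\<lambda>b d. \<Psi> a (\<tau> b \<cdot> t) q d) = DA s y (\<lambda>b d. DA s b (\<lambda>b c. \<Psi> a (b \<cdot> \<sigma> (S (\<pi> c)) \<cdot> t) q d))"
      by (subst linear_image_tau[of s "\<lambda>b. \<Psi> a (b \<cdot> t) q _"]) (simp_all only: L)
    then show ?thesis by (simp only: L coas)
  qed
  have "sw_RR RA s x y \<Phi> = DA s x (\<lambda>u v. DA s v (\<lambda>p q. DA s y (\<lambda>b d. DA s p (\<lambda>p1 p2.
      \<Psi> (\<tau> u \<cdot> \<sigma> (\<pi> p1)) (\<tau> b \<cdot> \<sigma> (S (\<pi> p2))) q d))))"
    by (simp only: sw_RR_eq[OF xy P eq] *)
  \<comment> \<open>The sum over y moves innermost, so that the coproducts of v and of its left leg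
    p become adjacent and coassociativity can detach p1 and regroup it with u.\<close>
  also have "\<dots> = DA s x (\<lambda>u v. DA s v (\<lambda>p q. DA s p (\<lambda>p1 p2. DA s y (\<lambda>b d.
      \<Psi> (\<tau> u \<cdot> \<sigma> (\<pi> p1)) (\<tau> b \<cdot> \<sigma> (S (\<pi> p2))) q d))))"
    using P(1) by (subst sw_swap[of s "comul A y"]) (auto simp: lin_iff)
  also have "\<dots> = DA s x (\<lambda>u v. DA s v (\<lambda>p1 w. DA s w (\<lambda>p2 q. DA s y (\<lambda>b d.
      \<Psi> (\<tau> u \<cdot> \<sigma> (\<pi> p1)) (\<tau> b \<cdot> \<sigma> (S (\<pi> p2))) q d))))"
    by (simp only: L coas)
  also have "\<dots> = DA s x (\<lambda>v w. DA s v (\<lambda>u p1. DA s w (\<lambda>p2 q. DA s y (\<lambda>b d.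
      \<Psi> (\<tau> u \<cdot> \<sigma> (\<pi> p1)) (\<tau> b \<cdot> \<sigma> (S (\<pi> p2))) q d))))"
    by (subst coassoc[OF coalg(1), where F = "\<lambda>u p1 w. DA s w (\<lambda>p2 q. DA s y (\<lambda>b d.
      \<Psi> (\<tau> u \<cdot> \<sigma> (\<pi> p1)) (\<tau> b \<cdot> \<sigma> (S (\<pi> p2))) q d))"]) (simp_all only: L)
  also have "\<dots> = DA s x (\<lambda>a w. DA s w (\<lambda>p q. DA s y (\<lambda>b d. \<Psi> a (\<tau> b \<cdot> \<sigma> (S (\<pi> p))) q d)))"
    by (subst tau_sigma_pi[of s "\<lambda>a. DA s _ (\<lambda>p q. DA s y (\<lambda>b d. \<Psi> a (\<tau> b \<cdot> \<sigma> (S (\<pi> p))) q d))"])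
      (simp_all only: L)
  finally show ?thesis by (simp only: **)
qed

text \<open>Right invariance turns the two remaining factors \<sigma>(S(\<pi>(c))) and
  \<sigma>(S(\<pi>(p))) into counits, which remove the legs c and p.\<close>

lemma sw_RR_invariant:
  assumes xy: "x \<in> R" "y \<in> R"
    and P: "\<And>b c d. lin sA s (\<lambda>a. \<Psi> a b c d)" "\<And>a c d. lin sA s (\<lambda>b. \<Psi> a b c d)"
      "\<And>a b d. lin sA s (\<lambda>c. \<Psi> a b c d)" "\<And>a b c. lin sA s (\<lambda>d. \<Psi> a b c d)"
    and eq: "\<And>a b c d. a \<in> R \<Longrightarrow> b \<in> R \<Longrightarrow> c \<in> R \<Longrightarrow> d \<in> R \<Longrightarrow> \<Phi> a b c d = \<Psi> a b c d"
    and bal: "\<And>a h b c d. \<Psi> (a \<cdot> \<sigma> h) b c d = \<Psi> a (\<sigma> h \<cdot> b) c d"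
    and inv: "\<And>a h b c d. \<Psi> a (b \<cdot> \<sigma> h) c d = s (counit H h) (\<Psi> a b c d)"
  shows "sw_RR RA s x y \<Phi> = DA s x (\<lambda>a q. DA s y (\<lambda>b e. \<Psi> a b q e))"
proof -
  have s: "vector_space s" using P(1) by (auto simp: lin_iff)
  note L = lins P linear_comp[OF P(1)] linear_comp[OF P(2)] linear_comp[OF P(3)] linear_comp[OF P(4)]
    linear_comp[OF linear_tau] linear_scale_const[OF s]
  \<comment> \<open>The counit is multiplicative, so evaluating it on h1 S(h2) compares it with its
    composite with S.\<close>
  have S: "counit H (S h) = counit H h" for h
  proof -
    have "counit H (S h) = DH (*) h (\<lambda>u v. counit H u * counit H (S v))"
      by (rule counit_left[OF coalg(2), symmetric]) (simp only: L)
    also have "\<dots> = DH (*) h (\<lambda>u v. counit H (u \<bullet> S v))"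
      by (simp only: counit_mul)
    also have "\<dots> = counit H h"
      by (subst antipode(2)[of "(*)" "counit H"]) (simp_all add: counit_mul linear_counit[OF coalg(2)])
    finally show ?thesis .
  qed
  have "sw_RR RA s x y \<Phi> = DA s x (\<lambda>a w. DA s w (\<lambda>p q. DA s y (\<lambda>b d. DA s d (\<lambda>c e.
      \<Psi> a (b \<cdot> \<sigma> (S (\<pi> c)) \<cdot> \<sigma> (S (\<pi> p))) q e))))"
    using xy P eq bal by (rule sw_RR_balanced)
  also have "\<dots> = DA s x (\<lambda>a w. DA s w (\<lambda>p q. s (counit A p) (DA s y (\<lambda>b e. \<Psi> a b q e))))"
    by (simp only: inv S counit_pi sw_scale[OF s] counit_left[OF coalg(1)] L)
  also have "\<dots> = DA s x (\<lambda>a q. DA s y (\<lambda>b e. \<Psi> a b q e))"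
  proof -
    have "DA s w (\<lambda>p q. s (counit A p) (DA s y (\<lambda>b e. \<Psi> a b q e))) = DA s y (\<lambda>b e. \<Psi> a b w e)" for a w
      by (rule counit_left[OF coalg(1)], rule linear_sw_param) (rule P)
    then show ?thesis by simp
  qed
  finally show ?thesis .
qed

section \<open>Bilinear forms and cocycles\<close>

definition bilinear_form where
  "bilinear_form f \<longleftrightarrow> (\<forall>y. lin sA (*) (\<lambda>x. f x y)) \<and> (\<forall>x. lin sA (*) (\<lambda>y. f x y))"

lemma bilinear_formD:
  assumes "bilinear_form f"
  shows "lin s0 sA p \<Longrightarrow> lin s0 (*) (\<lambda>x. f (p x) c)" "lin s0 sA p \<Longrightarrow> lin s0 (*) (\<lambda>y. f c (p y))"
    "lin sA (*) (\<lambda>x. f x c)" "lin sA (*) (\<lambda>y. f c y)"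
  using assms linear_comp[of sA "(*)" "\<lambda>x. f x c" s0 p] linear_comp[of sA "(*)" "\<lambda>y. f c y" s0 p]
  by (auto simp: bilinear_form_def)

lemma bilinear_form_bilin_on: "bilinear_form f \<longleftrightarrow> bilin_on UNIV UNIV sA sA (*) f"
  using vs vs_field by (auto simp: bilinear_form_def bilin_on_def lin_iff)

lemma bilinear_form_counit: "bilinear_form (\<lambda>x y. counit A x * counit A y)"
  unfolding bilinear_form_def by (simp only: lins simp_thms)

lemma bilinear_form_conv:
  assumes "bilinear_form f" "bilinear_form g"
  shows "bilinear_form (conv_A A f g)"
  unfolding bilinear_form_def conv_A_def
  by (simp only: lins bilinear_formD[OF assms(1)] bilinear_formD[OF assms(2)] simp_thms)

text \<open>The maps (x, h) to x\<sigma>(h) and (h, y) to \<sigma>(h)y are coalgebra maps into A,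
  because \<sigma> and the product of A are; pulling forms back along them respects
  convolution.\<close>

lemma conv_A_transport:
  assumes "bilinear_form f" "bilinear_form g"
  shows "conv3 A H A (\<lambda>x h y. f (x \<cdot> \<sigma> h) y) (\<lambda>x h y. g (x \<cdot> \<sigma> h) y) = (\<lambda>x h y. conv_A A f g (x \<cdot> \<sigma> h) y)"
    and "conv3 A H A (\<lambda>x h y. f x (\<sigma> h \<cdot> y)) (\<lambda>x h y. g x (\<sigma> h \<cdot> y)) = (\<lambda>x h y. conv_A A f g x (\<sigma> h \<cdot> y))"
    and "conv3 H A A (\<lambda>h x y. f (\<sigma> h \<cdot> x) y) (\<lambda>h x y. g (\<sigma> h \<cdot> x) y) = (\<lambda>h x y. conv_A A f g (\<sigma> h \<cdot> x) y)"
    and "conv3 A A H (\<lambda>x y h. f x (y \<cdot> \<sigma> h)) (\<lambda>x y h. g x (y \<cdot> \<sigma> h)) = (\<lambda>x y h. conv_A A f g x (y \<cdot> \<sigma> h))"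
  unfolding conv3_def conv_A_def
  by (simp_all only: lins bilinear_formD[OF assms(1)] bilinear_formD[OF assms(2)] DA_mul DA_sigma)

text \<open>The pullback along the counit of H respects convolution in the same way: the H-factor
  contributes the square of the counit under convolution, which is the counit.\<close>

lemma conv_A_counit_scaled:
  assumes "bilinear_form f" "bilinear_form g"
  shows "conv3 H A A (\<lambda>h x y. counit H h * f x y) (\<lambda>h x y. counit H h * g x y) = (\<lambda>h x y. counit H h * conv_A A f g x y)"
    and "conv3 A A H (\<lambda>x y h. counit H h * f x y) (\<lambda>x y h. counit H h * g x y) = (\<lambda>x y h. counit H h * conv_A A f g x y)"
proof -
  have e: "DH (*) h (\<lambda>h1 h2. counit H h1 * (counit H h2 * c)) = counit H h * c" for h c
    by (rule counit_left[OF coalg(2)]) (simp only: lins)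
  have m': "a * b * (c * d) = a * (c * (b * d))" for a b c d :: 'k by simp
  show "conv3 H A A (\<lambda>h x y. counit H h * f x y) (\<lambda>h x y. counit H h * g x y) = (\<lambda>h x y. counit H h * conv_A A f g x y)"
    unfolding conv3_def conv_A_def m' sw_mult_left[symmetric] e ..
  show "conv3 A A H (\<lambda>x y h. counit H h * f x y) (\<lambda>x y h. counit H h * g x y) = (\<lambda>x y h. counit H h * conv_A A f g x y)"
    unfolding conv3_def conv_A_def sw_mult_left m' e ..
qed

lemma trilin_transport:
  assumes "bilinear_form f"
  shows "trilin A H A (\<lambda>x h y. f (x \<cdot> \<sigma> h) y)" "trilin A H A (\<lambda>x h y. f x (\<sigma> h \<cdot> y))"
    "trilin H A A (\<lambda>h x y. f (\<sigma> h \<cdot> x) y)" "trilin A A H (\<lambda>x y h. f x (y \<cdot> \<sigma> h))"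
    "trilin H A A (\<lambda>h x y. counit H h * f x y)" "trilin A A H (\<lambda>x y h. counit H h * f x y)"
  unfolding trilin_def
  by (simp_all only: lins bilinear_formD[OF assms] simp_thms)

definition conv_inv where
  "conv_inv f g \<longleftrightarrow> bilinear_form f \<and> bilinear_form g \<and>
     conv_A A f g = (\<lambda>x y. counit A x * counit A y) \<and> conv_A A g f = (\<lambda>x y. counit A x * counit A y)"

lemma conv_inverse_A_iff: "bilinear_form f \<Longrightarrow> conv_inverse_A A f g \<longleftrightarrow> conv_inv f g"
  by (auto simp: conv_inverse_A_def conv_inv_def bilinear_form_bilin_on fun_eq_iff)

lemma counit3_transport:
  "(\<lambda>x h y. counit A (x \<cdot> \<sigma> h) * counit A y) = counit3 A H A"
  "(\<lambda>x h y. counit A x * counit A (\<sigma> h \<cdot> y)) = counit3 A H A"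
  "(\<lambda>h x y. counit A (\<sigma> h \<cdot> x) * counit A y) = counit3 H A A"
  "(\<lambda>x y h. counit A x * counit A (y \<cdot> \<sigma> h)) = counit3 A A H"
  "(\<lambda>h x y. counit H h * (counit A x * counit A y)) = counit3 H A A"
  "(\<lambda>x y h. counit H h * (counit A x * counit A y)) = counit3 A A H"
  by (auto simp: fun_eq_iff counit3_def counit_mul sigma)

text \<open>For a bilinear form this says that it factors through the tensor product of A with
  itself over H, where H acts through \<sigma>.\<close>

definition balanced where
  "balanced f \<longleftrightarrow> (\<forall>a h b. f (a \<cdot> \<sigma> h) b = f a (\<sigma> h \<cdot> b))"

definition left_invariant where
  "left_invariant f \<longleftrightarrow> (\<forall>a h b. f (\<sigma> h \<cdot> a) b = counit H h * f a b)"

definition right_invariant where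
  "right_invariant f \<longleftrightarrow> (\<forall>a h b. f a (b \<cdot> \<sigma> h) = counit H h * f a b)"

text \<open>The forms are tensored with the counit of H so that the three-factor uniqueness applies;
  evaluating at the unit of H removes the auxiliary factor.\<close>

lemma conv_inverse_unique:
  assumes "bilinear_form g" "conv_A A g f = (\<lambda>x y. counit A x * counit A y)" "conv_inv f g'"
  shows "g = g'"
proof -
  have bf: "bilinear_form f" and bg: "bilinear_form g" and bg': "bilinear_form g'"
    using assms by (simp_all add: conv_inv_def)
  have "(\<lambda>h x y. counit H h * g x y) = (\<lambda>h x y. counit H h * g' x y)"
    by (rule conv3_inverse_unique[OF coalg(2,1,1) trilin_transport(5)[OF bf]])
      (use assms in \<open>auto simp: conv_inv_def trilin_transport[OF bg] trilin_transport[OF bg'] trilin_transport[OF bf]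
          conv_A_counit_scaled[OF bg bf] conv_A_counit_scaled[OF bf bg'] counit3_transport\<close>)
  then show ?thesis
    by (auto simp: fun_eq_iff dest!: spec[of _ "unity H"] simp: counit_mul)
qed

lemma inv_A_eq: "conv_inv f g \<Longrightarrow> inv_A A f = g"
  unfolding inv_A_def
  by (rule the_equality) (auto simp: conv_inverse_A_iff conv_inv_def intro: conv_inverse_unique)

text \<open>The two pullbacks of g to A x H x A are inverse to the two pullbacks of f. The latter
  coincide because f is balanced, hence so do their inverses.\<close>

lemma balanced_inverse:
  assumes "conv_inv f g" "balanced f"
  shows "balanced g"
proof -
  have bf: "bilinear_form f" and bg: "bilinear_form g"
    using assms(1) by (simp_all add: conv_inv_def)
  have f: "(\<lambda>x h y. f (x \<cdot> \<sigma> h) y) = (\<lambda>x h y. f x (\<sigma> h \<cdot> y))"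
    using assms(2) by (simp add: balanced_def)
  have *: "conv3 A H A (\<lambda>x h y. f (x \<cdot> \<sigma> h) y) (\<lambda>x h y. g x (\<sigma> h \<cdot> y)) = counit3 A H A"
    unfolding f using assms(1) by (simp add: conv_inv_def conv_A_transport[OF bf bg] counit3_transport)
  have "(\<lambda>x h y. g (x \<cdot> \<sigma> h) y) = (\<lambda>x h y. g x (\<sigma> h \<cdot> y))"
    by (rule conv3_inverse_unique[OF coalg(1,2,1) trilin_transport(1)[OF bf]])
      (use assms * in \<open>auto simp: conv_inv_def trilin_transport[OF bf] trilin_transport[OF bg] conv_A_transport[OF bg bf] counit3_transport\<close>)
  then show ?thesis by (auto simp: balanced_def fun_eq_iff)
qed

text \<open>Again two pullbacks of f coincide, now along \<sigma>(h)x and along the counit of H, and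
  their inverses are the corresponding pullbacks of g.\<close>

lemma left_invariant_inverse:
  assumes "conv_inv f g" "left_invariant f"
  shows "left_invariant g"
proof -
  have bf: "bilinear_form f" and bg: "bilinear_form g"
    using assms(1) by (simp_all add: conv_inv_def)
  have f: "(\<lambda>h x y. f (\<sigma> h \<cdot> x) y) = (\<lambda>h x y. counit H h * f x y)"
    using assms(2) by (simp add: left_invariant_def)
  have *: "conv3 H A A (\<lambda>h x y. f (\<sigma> h \<cdot> x) y) (\<lambda>h x y. counit H h * g x y) = counit3 H A A"
    unfolding f using assms(1) by (simp add: conv_inv_def conv_A_counit_scaled[OF bf bg] counit3_transport)
  have "(\<lambda>h x y. g (\<sigma> h \<cdot> x) y) = (\<lambda>h x y. counit H h * g x y)"
    by (rule conv3_inverse_unique[OF coalg(2,1,1) trilin_transport(3)[OF bf]])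
      (use assms * in \<open>auto simp: conv_inv_def trilin_transport[OF bf] trilin_transport[OF bg] conv_A_transport[OF bg bf] counit3_transport\<close>)
  then show ?thesis by (auto simp: left_invariant_def fun_eq_iff)
qed

lemma right_invariant_inverse:
  assumes "conv_inv f g" "right_invariant f"
  shows "right_invariant g"
proof -
  have bf: "bilinear_form f" and bg: "bilinear_form g"
    using assms(1) by (simp_all add: conv_inv_def)
  have f: "(\<lambda>x y h. f x (y \<cdot> \<sigma> h)) = (\<lambda>x y h. counit H h * f x y)"
    using assms(2) by (simp add: right_invariant_def)
  have *: "conv3 A A H (\<lambda>x y h. f x (y \<cdot> \<sigma> h)) (\<lambda>x y h. counit H h * g x y) = counit3 A A H"
    unfolding f using assms(1) by (simp add: conv_inv_def conv_A_counit_scaled[OF bf bg] counit3_transport)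
  have "(\<lambda>x y h. g x (y \<cdot> \<sigma> h)) = (\<lambda>x y h. counit H h * g x y)"
    by (rule conv3_inverse_unique[OF coalg(1,1,2) trilin_transport(4)[OF bf]])
      (use assms * in \<open>auto simp: conv_inv_def trilin_transport[OF bf] trilin_transport[OF bg] conv_A_transport[OF bg bf] counit3_transport\<close>)
  then show ?thesis by (auto simp: right_invariant_def fun_eq_iff)
qed

end

section \<open>The cocycle, its inverse, and forms determined by their values on R\<close>

locale splitting_cocycle = splitting H A \<pi> \<sigma>
  for H :: "('k::field, 'h::ab_group_add) hopf"
    and A :: "('k, 'a::ab_group_add) bialg"
    and \<pi> :: "'a \<Rightarrow> 'h" and \<sigma> :: "'h \<Rightarrow> 'a" +
  fixes \<gamma> :: "'a \<Rightarrow> 'a \<Rightarrow> 'k"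
  assumes Z2: "\<gamma> \<in> Z2 A H \<sigma>"
begin

abbreviation "\<gamma>' \<equiv> inv_A A \<gamma>"

lemma bilinear_form_gamma: "bilinear_form \<gamma>"
  using Z2 by (simp add: Z2_def bilinear_form_bilin_on)

lemma conv_inv_gamma: "conv_inv \<gamma> \<gamma>'"
proof -
  obtain g where "conv_inverse_A A \<gamma> g" using Z2 by (auto simp: Z2_def)
  then have "conv_inv \<gamma> g" using bilinear_form_gamma by (simp add: conv_inverse_A_iff)
  then show ?thesis using inv_A_eq by simp
qed

lemma bilinear_form_gamma': "bilinear_form \<gamma>'"
  using conv_inv_gamma by (simp add: conv_inv_def)

lemma gamma_invariant:
  "\<gamma> (\<sigma> h \<cdot> a) (a' \<cdot> \<sigma> h') = counit H h * \<gamma> a a' * counit H h'"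
  using Z2 by (simp add: Z2_def)

lemma gamma_one: "\<gamma> x (unity A) = counit A x" "\<gamma> (unity A) x = counit A x"
  using Z2 by (auto simp: Z2_def)

lemma left_invariant_gamma: "left_invariant \<gamma>" and right_invariant_gamma: "right_invariant \<gamma>"
  using gamma_invariant[where h = "unity H"] gamma_invariant[where h' = "unity H"]
  by (auto simp: left_invariant_def right_invariant_def sigma counit_mul)

lemma gamma_sigma: "\<gamma> x (\<sigma> h) = counit A x * counit H h" "\<gamma> (\<sigma> h) x = counit H h * counit A x"
  using left_invariant_gamma[unfolded left_invariant_def, rule_format, of h "unity A" x]
    right_invariant_gamma[unfolded right_invariant_def, rule_format, of x "unity A" h]
  by (simp_all add: gamma_one)

lemmas lins_gamma = lins bilinear_formD[OF bilinear_form_gamma] bilinear_formD[OF bilinear_form_gamma']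

lemma balanced_gamma: "balanced \<gamma>"
  unfolding balanced_def
proof (intro allI)
  fix x h z
  \<comment> \<open>In the cocycle condition with middle argument \<sigma>(h), the factors
    \<gamma>(\<sigma>(h1), z1) and \<gamma>(x1, \<sigma>(h1)) are products of counits, so each side
    reduces to its other factor.\<close>
  have "DA (*) (\<sigma> h) (\<lambda>y1 y2. DA (*) z (\<lambda>z1 z2. \<gamma> y1 z1 * \<gamma> x (y2 \<cdot> z2))) =
    DA (*) x (\<lambda>x1 x2. DA (*) (\<sigma> h) (\<lambda>y1 y2. \<gamma> x1 y1 * \<gamma> (x2 \<cdot> y2) z))"
    using Z2 by (auto simp: Z2_def)
  moreover have "DA (*) (\<sigma> h) (\<lambda>y1 y2. DA (*) z (\<lambda>z1 z2. \<gamma> y1 z1 * \<gamma> x (y2 \<cdot> z2))) = \<gamma> x (\<sigma> h \<cdot> z)"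
    by (simp only: lins_gamma DA_sigma gamma_sigma mult.assoc sw_mult_left[symmetric]
      counit_left[OF coalg(1), of "(*)"] counit_left[OF coalg(2), of "(*)"])
  moreover have "DA (*) x (\<lambda>x1 x2. DA (*) (\<sigma> h) (\<lambda>y1 y2. \<gamma> x1 y1 * \<gamma> (x2 \<cdot> y2) z)) = \<gamma> (x \<cdot> \<sigma> h) z"
    by (simp only: lins_gamma DA_sigma gamma_sigma mult.assoc sw_mult_left[symmetric]
      counit_left[OF coalg(1), of "(*)"] counit_left[OF coalg(2), of "(*)"])
  ultimately show "\<gamma> (x \<cdot> \<sigma> h) z = \<gamma> x (\<sigma> h \<cdot> z)" by simp
qed

lemmas gamma_rules =
  balanced_gamma[unfolded balanced_def, rule_format]
  right_invariant_gamma[unfolded right_invariant_def, rule_format]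
  balanced_inverse[OF conv_inv_gamma balanced_gamma, unfolded balanced_def, rule_format]
  right_invariant_inverse[OF conv_inv_gamma right_invariant_gamma, unfolded right_invariant_def, rule_format]

lemma gamma'_one: "\<gamma>' x (unity A) = counit A x" "\<gamma>' (unity A) x = counit A x"
proof -
  have "conv_A A \<gamma> \<gamma>' x (unity A) = \<gamma>' x (unity A)"
    by (simp only: conv_A_def lins_gamma DA_unity gamma_one counit_left[OF coalg(1), of "(*)"])
  then show "\<gamma>' x (unity A) = counit A x"
    using conv_inv_gamma by (simp add: conv_inv_def counit_mul)
  have "conv_A A \<gamma> \<gamma>' (unity A) x = \<gamma>' (unity A) x"
    by (simp only: conv_A_def lins_gamma DA_unity gamma_one counit_left[OF coalg(1), of "(*)"])
  then show "\<gamma>' (unity A) x = counit A x"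
    using conv_inv_gamma by (simp add: conv_inv_def counit_mul)
qed

lemma gamma'_sigma: "\<gamma>' x (\<sigma> h) = counit A x * counit H h" "\<gamma>' (\<sigma> h) x = counit H h * counit A x"
proof -
  show "\<gamma>' x (\<sigma> h) = counit A x * counit H h"
    using gamma_rules(4)[of x "unity A" h] by (simp add: gamma'_one)
  show "\<gamma>' (\<sigma> h) x = counit H h * counit A x"
    using left_invariant_inverse[OF conv_inv_gamma left_invariant_gamma,
      unfolded left_invariant_def, rule_format, of h "unity A" x] by (simp add: gamma'_one)
qed

text \<open>Decompose both arguments by \<open>tau_sigma_pi\<close>. In the second one right
  invariance erases \<sigma>(\<pi>(c2)), so c may be replaced by \<tau>(c); in the first one balance
  moves \<sigma>(\<pi>(a2)) across.\<close>

lemma balanced_determined: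
  assumes F: "bilinear_form F" "balanced F" "right_invariant F"
  shows "F a b = DA (*) a (\<lambda>a1 a2. F (\<tau> a1) (\<tau> (\<sigma> (\<pi> a2) \<cdot> b)))"
proof -
  have r: "F r c = F r (\<tau> c)" for r c
  proof -
    have "F r c = DA (*) c (\<lambda>u v. F r (\<tau> u \<cdot> \<sigma> (\<pi> v)))"
      by (rule tau_sigma_pi[symmetric]) (rule bilinear_formD[OF F(1)])
    also have "\<dots> = DA (*) c (\<lambda>u v. counit A v * F r (\<tau> u))"
      using F(3) by (simp add: right_invariant_def counit_pi)
    also have "\<dots> = F r (\<tau> c)"
      by (rule counit_right[OF coalg(1)]) (rule bilinear_formD[OF F(1)] linear_tau)+
    finally show ?thesis .
  qed
  have "F a b = DA (*) a (\<lambda>u v. F (\<tau> u \<cdot> \<sigma> (\<pi> v)) b)"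
    by (rule tau_sigma_pi[symmetric]) (rule bilinear_formD[OF F(1)])
  then show ?thesis
    using F(2) r by (simp add: balanced_def)
qed

lemma balanced_eqI:
  assumes F: "bilinear_form F" "balanced F" "right_invariant F"
    and G: "bilinear_form G" "balanced G" "right_invariant G"
    and eq: "\<And>x y. x \<in> R \<Longrightarrow> y \<in> R \<Longrightarrow> F x y = G x y"
  shows "F = G"
  by (intro ext, subst balanced_determined[OF F], subst balanced_determined[OF G])
    (simp add: eq tau_mem)

lemma balanced_conv:
  assumes F: "bilinear_form F" "balanced F" and G: "bilinear_form G" "balanced G"
  shows "balanced (conv_A A F G)"
proof -
  have "(\<lambda>x h y. F (x \<cdot> \<sigma> h) y) = (\<lambda>x h y. F x (\<sigma> h \<cdot> y))"
    "(\<lambda>x h y. G (x \<cdot> \<sigma> h) y) = (\<lambda>x h y. G x (\<sigma> h \<cdot> y))"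
    using F G by (simp_all add: balanced_def)
  then have "(\<lambda>x h y. conv_A A F G (x \<cdot> \<sigma> h) y) = (\<lambda>x h y. conv_A A F G x (\<sigma> h \<cdot> y))"
    by (simp only: conv_A_transport(1,2)[OF F(1) G(1), symmetric])
  then show ?thesis by (auto simp: balanced_def fun_eq_iff)
qed

lemma right_invariant_conv:
  assumes F: "bilinear_form F" "right_invariant F" and G: "bilinear_form G" "right_invariant G"
  shows "right_invariant (conv_A A F G)"
proof -
  have "(\<lambda>x y h. F x (y \<cdot> \<sigma> h)) = (\<lambda>x y h. counit H h * F x y)"
    "(\<lambda>x y h. G x (y \<cdot> \<sigma> h)) = (\<lambda>x y h. counit H h * G x y)"
    using F G by (simp_all add: right_invariant_def)
  then have "(\<lambda>x y h. conv_A A F G x (y \<cdot> \<sigma> h)) = (\<lambda>x y h. counit H h * conv_A A F G x y)"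
    by (simp only: conv_A_transport(4)[OF F(1) G(1), symmetric]
      conv_A_counit_scaled(2)[OF F(1) G(1), symmetric])
  then show ?thesis by (auto simp: right_invariant_def fun_eq_iff)
qed

lemma invariant_counit:
  "balanced (\<lambda>x y. counit A x * counit A y)" "right_invariant (\<lambda>x y. counit A x * counit A y)"
  by (simp_all add: balanced_def right_invariant_def counit_mul sigma)

text \<open>In the braided comultiplication the action falls on y1, an argument of the first factor;
  this is why balance and right invariance are asked of F.\<close>

lemma conv_RR_restrict:
  assumes xy: "x \<in> R" "y \<in> R"
    and F: "bilinear_form F" "balanced F" "right_invariant F" and G: "bilinear_form G"
    and eq: "\<And>x y. x \<in> R \<Longrightarrow> y \<in> R \<Longrightarrow> f x y = F x y" "\<And>x y. x \<in> R \<Longrightarrow> y \<in> R \<Longrightarrow> g x y = G x y"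
  shows "conv_RR RA (*) (*) f g x y = conv_A A F G x y"
  unfolding conv_RR_def conv_A_def
  by (rule sw_RR_invariant[OF xy, where \<Psi> = "\<lambda>a b c d. F a b * G c d"])
    (use F in \<open>simp_all only: lins bilinear_formD[OF F(1)] bilinear_formD[OF G] eq balanced_def
      right_invariant_def mult.assoc\<close>)

text \<open>The only candidate for a balanced and right invariant extension of a form on \<open>R\<close>, by
  \<open>balanced_determined\<close>.\<close>

definition extension where
  "extension g a b = DA (*) a (\<lambda>a1 a2. g (\<tau> a1) (\<tau> (\<sigma> (\<pi> a2) \<cdot> b)))"

text \<open>The form f(u, v) = g(\<tau>(u), \<tau>(v)) is total and, by
  \<open>tau_mul_sigma\<close>, sends a right factor \<sigma>(h) in either argument to a counit.
  Replacing a by a\<sigma>(h) therefore leaves just \<sigma>(\<pi>(a2)) \<sigma>(h) b in the second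
  argument, which is balance. For a in R, coinvariance replaces \<pi>(a2) by 1, so g is
  recovered.\<close>

lemma
  assumes g: "bilin_on R R sA sA (*) g"
  shows bilinear_form_extension: "bilinear_form (extension g)"
    and balanced_extension: "balanced (extension g)"
    and right_invariant_extension: "right_invariant (extension g)"
    and extension_eq: "x \<in> R \<Longrightarrow> y \<in> R \<Longrightarrow> extension g x y = g x y"
proof -
  define f where "f u v = g (\<tau> u) (\<tau> v)" for u v
  have bf: "bilinear_form f"
    using g vs vs_field
    by (auto simp: bilinear_form_def f_def lin_iff bilin_on_def linD[OF linear_tau] tau_mem)
  note L = lins bilinear_formD[OF bf]
  have f_sigma: "f (u \<cdot> \<sigma> h) v = counit H h * f u v" "f u (v \<cdot> \<sigma> h) = counit H h * f u v" for u v h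
    using g by (simp_all add: f_def tau_mul_sigma bilin_on_def tau_mem)
  have e: "extension g = (\<lambda>a b. DA (*) a (\<lambda>a1 a2. f a1 (\<sigma> (\<pi> a2) \<cdot> b)))"
    by (simp add: extension_def fun_eq_iff f_def)
  show "bilinear_form (extension g)"
    unfolding bilinear_form_def e by (simp only: L simp_thms)
  show "balanced (extension g)"
    unfolding balanced_def e
    by (simp only: L DA_mul DA_sigma f_sigma counit_left[OF coalg(2), of "(*)"] pi_bimodule sigma assoc simp_thms)
  show "right_invariant (extension g)"
    unfolding right_invariant_def e
    by (simp only: assoc(1)[symmetric] f_sigma sw_mult_left simp_thms)
  show "extension g x y = g x y" if "x \<in> R" "y \<in> R"
  proof -
    have "extension g x y = f x (\<sigma> (unity H) \<cdot> y)"
      unfolding e by (rule coinvariantD[OF that(1), of "(*)" "\<lambda>u h. f u (\<sigma> h \<cdot> y)"]) (simp_all only: L)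
    then show ?thesis by (simp add: sigma f_def tau_of_coinvariant that)
  qed
qed

lemma scale_mulH: "sH c u \<bullet> v = sH c (u \<bullet> v)" "u \<bullet> sH c v = sH c (u \<bullet> v)"
  using bilin_mul(2) by (auto simp: bilin_on_def)

text \<open>Regrouping merges p and u into one coproduct, to which the antipode axiom applies
  because \<pi> is a coalgebra map. It serves to cancel an antipode factor left by the braiding
  against a coaction factor.\<close>

lemma antipode_pi_cancel:
  assumes F: "\<And>h. lin sA s (\<lambda>v. F v h)" "\<And>v. lin sH s (\<lambda>h. F v h)"
  shows "DA s w (\<lambda>p q. DA s q (\<lambda>u v. F v (S (\<pi> p) \<bullet> \<pi> u))) = F w (unity H)"
proof -
  have s: "vector_space s" using F(1) by (auto simp: lin_iff)
  note L = lins F linear_comp[OF F(1)] linear_comp[OF F(2)] linear_scale_const[OF s]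
  have "DA s w (\<lambda>p q. DA s q (\<lambda>u v. F v (S (\<pi> p) \<bullet> \<pi> u))) =
      DA s w (\<lambda>t v. DA s t (\<lambda>p u. F v (S (\<pi> p) \<bullet> \<pi> u)))"
    by (simp only: L coas)
  also have "\<dots> = DA s w (\<lambda>t v. DH s (\<pi> t) (\<lambda>p u. F v (S p \<bullet> u)))"
    by (simp only: L DH_pi)
  also have "\<dots> = DA s w (\<lambda>t v. s (counit A t) (F v (unity H)))"
    by (subst antipode(1)[of s "F _"]) (simp_all only: L counit_pi)
  also have "\<dots> = F w (unity H)"
    by (rule counit_left[OF coalg(1)]) (simp only: L)
  finally show ?thesis .
qed

end

context splitting_cocycle
begin

section \<open>The twisted structures\<close>

abbreviation "Ag \<equiv> twist_A A \<gamma>"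
abbreviation mulg (infixl "\<star>" 70) where "a \<star> b \<equiv> mul Ag a b"
abbreviation "\<gamma>R \<equiv> restrict2 R \<gamma>"

lemma restrict2_simps [simp]:
  "x \<in> B \<Longrightarrow> y \<in> B \<Longrightarrow> restrict2 B f x y = f x y" "restrict2 B (restrict2 B f) = restrict2 B f"
  by (auto simp: restrict2_def fun_eq_iff)

lemma restrict2_cong:
  "(\<And>x y. x \<in> B \<Longrightarrow> y \<in> B \<Longrightarrow> f x y = g x y) \<Longrightarrow> restrict2 B f = restrict2 B g"
  by (auto simp: restrict2_def fun_eq_iff)

lemma balanced_gamma': "balanced \<gamma>'" and right_invariant_gamma': "right_invariant \<gamma>'"
  using balanced_inverse[OF conv_inv_gamma balanced_gamma]
    right_invariant_inverse[OF conv_inv_gamma right_invariant_gamma] by auto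

lemma conv_inverse_RR_gamma: "conv_inverse_RR RA \<gamma>R (restrict2 R \<gamma>')"
proof -
  have "bilin_on R R sA sA (*) (restrict2 R \<gamma>')"
    using bilinear_form_gamma'[unfolded bilinear_form_bilin_on]
    by (simp add: bilin_on_def coinvariant_closed)
  moreover have "conv_RR RA (*) (*) \<gamma>R (restrict2 R \<gamma>') x y = counit A x * counit A y"
    "conv_RR RA (*) (*) (restrict2 R \<gamma>') \<gamma>R x y = counit A x * counit A y" if "x \<in> R" "y \<in> R" for x y
    using conv_inv_gamma
      conv_RR_restrict[OF that bilinear_form_gamma balanced_gamma right_invariant_gamma bilinear_form_gamma',
        of \<gamma>R "restrict2 R \<gamma>'"]
      conv_RR_restrict[OF that bilinear_form_gamma' balanced_gamma' right_invariant_gamma' bilinear_form_gamma,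
        of "restrict2 R \<gamma>'" \<gamma>R]
    by (simp_all add: conv_inv_def)
  ultimately show ?thesis
    by (simp add: conv_inverse_RR_def RA_simps)
qed

text \<open>The extension G of g satisfies G * \<gamma> = counit on R. Both sides are balanced and
  right invariant on A, so the identity holds on all of A, and uniqueness of inverses there gives G
  = \<gamma>'.\<close>

lemma conv_inverse_RR_unique:
  assumes "conv_inverse_RR RA \<gamma>R g"
  shows "g = restrict2 R \<gamma>'"
proof -
  let ?G = "extension g"
  have g: "bilin_on R R sA sA (*) g" "restrict2 R g = g"
    and inv: "\<And>x y. x \<in> R \<Longrightarrow> y \<in> R \<Longrightarrow> conv_RR RA (*) (*) g \<gamma>R x y = counit A x * counit A y"
    using assms by (auto simp: conv_inverse_RR_def RA_simps)
  note G = bilinear_form_extension[OF g(1)] balanced_extension[OF g(1)] right_invariant_extension[OF g(1)]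
  have "conv_A A ?G \<gamma> = (\<lambda>x y. counit A x * counit A y)"
  proof (rule balanced_eqI)
    show "conv_A A ?G \<gamma> x y = counit A x * counit A y" if "x \<in> R" "y \<in> R" for x y
      using conv_RR_restrict[OF that G bilinear_form_gamma, of g \<gamma>R] extension_eq[OF g(1)] inv[OF that] by simp
  qed (intro bilinear_form_conv balanced_conv right_invariant_conv G bilinear_form_gamma
      balanced_gamma right_invariant_gamma bilinear_form_counit invariant_counit)+
  then have "?G = \<gamma>'"
    by (rule conv_inverse_unique[OF G(1) _ conv_inv_gamma])
  then have "restrict2 R g = restrict2 R \<gamma>'"
    using extension_eq[OF g(1)] by (intro restrict2_cong) simp
  then show ?thesis by (simp add: g)
qed

lemma inv_RR_gamma: "inv_RR RA \<gamma>R = restrict2 R \<gamma>'"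
  unfolding inv_RR_def using conv_inverse_RR_gamma conv_inverse_RR_unique by (rule the_equality)

lemma mulg_def: "x \<star> y =
     DA sA x (\<lambda>x1 x'. DA sA x' (\<lambda>x2 x3. DA sA y (\<lambda>y1 y'. DA sA y' (\<lambda>y2 y3.
       sA (\<gamma> x1 y1 * \<gamma>' x3 y3) (x2 \<cdot> y2)))))"
  by (simp add: twist_A_def)

lemma mulg_sigma: "a \<star> \<sigma> h = a \<cdot> \<sigma> h" "\<sigma> h \<star> a = \<sigma> h \<cdot> a"
proof -
  have s: "sA (a * b * (c * d)) v = sA a (sA c (sA b (sA d v)))"
    "sA (b * a * (d * c)) v = sA b (sA d (sA a (sA c v)))" for a b c d v
    by (simp_all add: vs_simps(3)[OF vs(1)] mult_ac)
  show "a \<star> \<sigma> h = a \<cdot> \<sigma> h"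
    unfolding mulg_def
    by (simp only: lins_gamma DA_sigma gamma_sigma gamma'_sigma s(1) sw_scale[OF vs(1)]
      counit_left[OF coalg(1), of sA] counit_left[OF coalg(2), of sA] counit_right[OF coalg(1), of sA] counit_right[OF coalg(2), of sA])
  show "\<sigma> h \<star> a = \<sigma> h \<cdot> a"
    unfolding mulg_def
    by (simp only: lins_gamma DA_sigma gamma_sigma gamma'_sigma s(1) sw_scale[OF vs(1)]
      counit_left[OF coalg(1), of sA] counit_left[OF coalg(2), of sA] counit_right[OF coalg(1), of sA] counit_right[OF coalg(2), of sA])
qed

lemma twist_A_simps:
  "scl Ag = sA" "comul Ag = comul A" "unity Ag = unity A" "counit Ag = counit A"
  "coinvariants Ag H \<pi> = R" "tau_map Ag H \<pi> \<sigma> = \<tau>"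
proof -
  show *: "scl Ag = sA" "comul Ag = comul A" "unity Ag = unity A" "counit Ag = counit A"
    by (simp_all add: twist_A_def)
  show "coinvariants Ag H \<pi> = R" by (simp add: coinvariants_def *)
  show "tau_map Ag H \<pi> \<sigma> = \<tau>" by (simp add: tau_map_def fun_eq_iff * mulg_sigma)
qed

text \<open>The convolution of \<gamma> with f after the product of A, used for f = \<tau> and f =
  \<pi>. The image of the twisted product under f is this map convolved with \<gamma>' on the right,
  which is the bracketing of the twice-iterated comultiplication of R \<otimes> R.\<close>

definition left_twist where
  "left_twist s f x y = DA s x (\<lambda>x1 x2. DA s y (\<lambda>y1 y2. s (\<gamma> x1 y1) (f (x2 \<cdot> y2))))"

context
  fixes s :: "'k \<Rightarrow> 'v \<Rightarrow> 'v::ab_group_add" and f :: "'a \<Rightarrow> 'v"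
  assumes f: "lin sA s f"
begin

lemma vs_target: "vector_space s"
  using f by (simp add: lin_iff)

lemmas lins_twist = lins_gamma linear_comp[OF f] linear_scale_const[OF vs_target]

lemma linear_left_twist:
  "lin s0 sA p \<Longrightarrow> lin s0 s (\<lambda>x. left_twist s f (p x) y)"
  "lin s0 sA p \<Longrightarrow> lin s0 s (\<lambda>y. left_twist s f x (p y))"
  unfolding left_twist_def by (simp_all only: lins_twist)

lemma left_twist_balanced: "left_twist s f (a \<cdot> \<sigma> h) b = left_twist s f a (\<sigma> h \<cdot> b)"
  unfolding left_twist_def
  by (simp only: lins_twist DA_mul DA_sigma gamma_rules assoc)

lemma image_mulg:
  "f (x \<star> y) = DA s x (\<lambda>a c. DA s y (\<lambda>b d. s (\<gamma>' c d) (left_twist s f a b)))"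
proof -
  have "f (x \<star> y) = DA s x (\<lambda>x1 x'. DA s x' (\<lambda>x2 x3. DA s y (\<lambda>y1 y'. DA s y' (\<lambda>y2 y3.
       s (\<gamma> x1 y1 * \<gamma>' x3 y3) (f (x2 \<cdot> y2))))))"
    unfolding mulg_def by (simp only: sw_linear_image[OF f] linD(2)[OF f])
  also have "\<dots> = DA s x (\<lambda>a c. DA s a (\<lambda>x1 x2. DA s y (\<lambda>b d. DA s b (\<lambda>y1 y2.
       s (\<gamma> x1 y1 * \<gamma>' c d) (f (x2 \<cdot> y2))))))"
    by (simp only: coas lins_twist)
  also have "\<dots> = DA s x (\<lambda>a c. DA s y (\<lambda>b d. DA s a (\<lambda>x1 x2. DA s b (\<lambda>y1 y2.
       s (\<gamma>' c d) (s (\<gamma> x1 y1) (f (x2 \<cdot> y2)))))))"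
    by (subst sw_swap[OF vs_target, of "comul A y"]) (simp only: vs_simps(3)[OF vs_target] mult.commute)
  finally show ?thesis
    by (simp only: left_twist_def sw_scale[OF vs_target])
qed

end

lemma left_twist_tau:
  "left_twist sA \<tau> a (b \<cdot> \<sigma> h) = sA (counit H h) (left_twist sA \<tau> a b)"
proof -
  have *: "sA (counit H h1 * c) (sA (counit H h2) v) = sA (counit H h1) (sA (counit H h2) (sA c v))" for h1 h2 c v
    by (simp add: vs_simps(3)[OF vs(1)] mult_ac)
  show ?thesis
    unfolding left_twist_def
    by (simp only: lins_twist[OF linear_tau] DA_mul DA_sigma gamma_rules assoc(1)[symmetric] tau_mul_sigma *
      counit_left[OF coalg(2), of sA] sw_scale[OF vs(1)])
qed

text \<open>Since \<pi> is right H-linear, h itself comes out where \<tau> would give its counit.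
  Right invariance is replaced by this H-linearity, and the antipode factors of
  \<open>sw_RR_balanced\<close> remain.\<close>

lemma left_twist_pi: "left_twist sH \<pi> a (b \<cdot> \<sigma> h) = left_twist sH \<pi> a b \<bullet> h"
proof -
  have "left_twist sH \<pi> a (b \<cdot> \<sigma> h) =
    DA sH a (\<lambda>a1 a2. DA sH b (\<lambda>b1 b2. DH sH h (\<lambda>h1 h2. sH (counit H h1) (sH (\<gamma> a1 b1) (\<pi> (a2 \<cdot> b2) \<bullet> h2)))))"
    unfolding left_twist_def
    by (simp only: lins_twist[OF linear_maps(2)] DA_mul DA_sigma gamma_rules assoc(1)[symmetric] pi_bimodule
      vs_simps(3)[OF vs(2)])
  also have "\<dots> = DA sH a (\<lambda>a1 a2. DA sH b (\<lambda>b1 b2. sH (\<gamma> a1 b1) (\<pi> (a2 \<cdot> b2)) \<bullet> h))"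
    by (simp only: lins_twist[OF linear_maps(2)] counit_left[OF coalg(2), of sH] scale_mulH)
  also have "\<dots> = left_twist sH \<pi> a b \<bullet> h"
  proof -
    have l: "lin sH sH (\<lambda>u. u \<bullet> h)" by (simp only: lins)
    show ?thesis unfolding left_twist_def by (simp only: sw_linear_image[OF l])
  qed
  finally show ?thesis .
qed

lemma twist_mul_eq:
  assumes xy: "x \<in> R" "y \<in> R"
  shows "mul (twist_R RA \<gamma>R) x y = \<tau> (x \<star> y)"
proof -
  note L = lins_twist[OF linear_tau] linear_left_twist[OF linear_tau]
  \<comment> \<open>The inner sum is converted while x3 and y3 are fixed; the result is the total
    map \<open>left_twist\<close>, itself balanced and right invariant, so the outer sum can be
    converted by the same lemma.\<close>
  have inner: "sw_RR RA sA x' y' (\<lambda>x1 y1 x2 y2. sA (\<gamma>R x1 y1 * restrict2 R \<gamma>' x3 y3) (mul RA x2 y2)) =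
      sA (\<gamma>' x3 y3) (left_twist sA \<tau> x' y')" if "x' \<in> R" "y' \<in> R" "x3 \<in> R" "y3 \<in> R" for x' y' x3 y3
  proof -
    have "sw_RR RA sA x' y' (\<lambda>x1 y1 x2 y2. sA (\<gamma>R x1 y1 * restrict2 R \<gamma>' x3 y3) (mul RA x2 y2)) =
      DA sA x' (\<lambda>x1 x2. DA sA y' (\<lambda>y1 y2. sA (\<gamma>' x3 y3) (sA (\<gamma> x1 y1) (\<tau> (x2 \<cdot> y2)))))"
      by (rule sw_RR_invariant[OF that(1,2), where \<Psi> = "\<lambda>a b c d. sA (\<gamma>' x3 y3) (sA (\<gamma> a b) (\<tau> (c \<cdot> d)))"])
        (simp_all add: L that RA_simps gamma_rules vs_simps(3)[OF vs(1)] mult_ac)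
    then show ?thesis by (simp only: sw_scale[OF vs(1)] left_twist_def)
  qed
  have "mul (twist_R RA \<gamma>R) x y = sw_RR RA sA x y (\<lambda>x' y' x3 y3. sw_RR RA sA x' y' (\<lambda>x1 y1 x2 y2.
       sA (\<gamma>R x1 y1 * restrict2 R \<gamma>' x3 y3) (mul RA x2 y2)))"
    by (simp add: twist_R_def RA_simps xy inv_RR_gamma)
  also have "\<dots> = DA sA x (\<lambda>a c. DA sA y (\<lambda>b d. sA (\<gamma>' c d) (left_twist sA \<tau> a b)))"
    by (rule sw_RR_invariant[OF xy, where \<Psi> = "\<lambda>a b c d. sA (\<gamma>' c d) (left_twist sA \<tau> a b)"])
      (simp_all only: L inner left_twist_balanced[OF linear_tau] left_twist_tau vs_simps(3)[OF vs(1)]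
        mult.commute[of "counit H _"])
  also have "\<dots> = \<tau> (x \<star> y)"
    by (rule image_mulg[OF linear_tau, symmetric])
  finally show ?thesis .
qed

lemma after_coact_eq:
  assumes xy: "x \<in> R" "y \<in> R"
  shows "after_coact_RR H RA (restrict2 R \<gamma>') x y =
    DA sH x (\<lambda>x1 x2. DA sH y (\<lambda>y1 y2. sH (\<gamma>' x2 y2) (\<pi> x1 \<bullet> \<pi> y1)))"
proof -
  have inner: "sw_on UNIV R sH (coact RA y) (\<lambda>h' y0. sH (restrict2 R \<gamma>' x0 y0) (h \<bullet> h')) =
    DA sH y (\<lambda>y1 y2. sH (\<gamma>' x0 y2) (h \<bullet> \<pi> y1))" if "x0 \<in> R" for h x0
    by (rule sw_coact_R[OF xy(2), where G = "\<lambda>h' y0. sH (\<gamma>' x0 y0) (h \<bullet> h')"])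
      (simp_all only: lins_gamma that restrict2_simps)
  show ?thesis
    unfolding after_coact_RR_def RA_simps
    by (rule sw_coact_R[OF xy(1), where G = "\<lambda>h x0. DA sH y (\<lambda>y1 y2. sH (\<gamma>' x0 y2) (h \<bullet> \<pi> y1))"])
      (simp_all only: lins_gamma inner)
qed

lemma twist_cocycle_eq:
  assumes xy: "x \<in> R" "y \<in> R"
  shows "twist_cocycle H RA \<gamma>R (associated_cocycle A H \<pi>) x y = \<pi> (x \<star> y)"
proof -
  note L = lins_twist[OF linear_maps(2)] linear_left_twist[OF linear_maps(2)] linear_ident[OF vs(1)]
  let ?V = "left_twist sH \<pi>"
  \<comment> \<open>The total version of the codiagonal coaction followed by \<gamma>', with
    \<gamma>' in place of its restriction to R.\<close>
  define W where "W q e = DA sH q (\<lambda>u v. DA sH e (\<lambda>m n. sH (\<gamma>' v n) (\<pi> u \<bullet> \<pi> m)))" for q e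
  have W: "lin sA sH (\<lambda>q. W q e)" "lin sA sH (\<lambda>e. W q e)" for q e
    unfolding W_def by (simp_all only: L)
  \<comment> \<open>Only \<gamma> stands in the first convolution factor here, so right invariance
    is still available at this stage.\<close>
  have inner: "conv_RR RA sH (mul H) (unit_after H \<gamma>R) (associated_cocycle A H \<pi>) x' y' = ?V x' y'"
    if "x' \<in> R" "y' \<in> R" for x' y'
    unfolding conv_RR_def left_twist_def
    by (rule sw_RR_invariant[OF that, where \<Psi> = "\<lambda>a b c d. sH (\<gamma> a b) (\<pi> (c \<cdot> d))"])
      (simp_all add: L gamma_rules unit_after_def associated_cocycle_def scale_mulH vs_simps(3)[OF vs(2)])
  \<comment> \<open>The order matters in the noncommutative H: S(\<pi>(p)) meets the coaction factor
    of q and cancels, and only then does S(\<pi>(c)) become adjacent to the coaction factor of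
    e.\<close>
  have cancel: "DA sH w (\<lambda>p q. DA sH d (\<lambda>c e. v \<bullet> S (\<pi> c) \<bullet> S (\<pi> p) \<bullet> W q e)) = sH (\<gamma>' w d) v" for w d v
  proof -
    have l: "lin sH sH (\<lambda>t. k \<bullet> t)" for k by (simp only: L)
    have "DA sH w (\<lambda>p q. DA sH d (\<lambda>c e. v \<bullet> S (\<pi> c) \<bullet> S (\<pi> p) \<bullet> W q e)) =
      DA sH w (\<lambda>p q. DA sH d (\<lambda>c e. DA sH q (\<lambda>r t. DA sH e (\<lambda>m n.
         sH (\<gamma>' t n) (v \<bullet> (S (\<pi> c) \<bullet> ((S (\<pi> p) \<bullet> \<pi> r) \<bullet> \<pi> m)))))))"
      unfolding W_def by (simp only: sw_linear_image[OF l] scale_mulH assoc)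
    also have "\<dots> = DA sH w (\<lambda>p q. DA sH q (\<lambda>r t. DA sH d (\<lambda>c e. DA sH e (\<lambda>m n.
         sH (\<gamma>' t n) (v \<bullet> (S (\<pi> c) \<bullet> ((S (\<pi> p) \<bullet> \<pi> r) \<bullet> \<pi> m)))))))"
      by (subst sw_swap[OF vs(2), of "comul A d"]) (rule refl)
    also have "\<dots> = DA sH d (\<lambda>c e. DA sH e (\<lambda>m n. sH (\<gamma>' w n) (v \<bullet> (S (\<pi> c) \<bullet> (unity H \<bullet> \<pi> m)))))"
      by (rule antipode_pi_cancel[where F = "\<lambda>t k. DA sH d (\<lambda>c e. DA sH e (\<lambda>m n.
         sH (\<gamma>' t n) (v \<bullet> (S (\<pi> c) \<bullet> (k \<bullet> \<pi> m)))))"]) (simp_all only: L)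
    also have "\<dots> = DA sH d (\<lambda>c e. DA sH e (\<lambda>m n. sH (\<gamma>' w n) (v \<bullet> (S (\<pi> c) \<bullet> \<pi> m))))"
      by (simp only: unit)
    also have "\<dots> = sH (\<gamma>' w d) (v \<bullet> unity H)"
      by (rule antipode_pi_cancel[where F = "\<lambda>n k. sH (\<gamma>' w n) (v \<bullet> k)"]) (simp_all only: L)
    finally show ?thesis by simp
  qed
  have "twist_cocycle H RA \<gamma>R (associated_cocycle A H \<pi>) x y =
      sw_RR RA sH x y (\<lambda>a b c d. conv_RR RA sH (mul H) (unit_after H \<gamma>R) (associated_cocycle A H \<pi>) a b \<bullet>
        after_coact_RR H RA (restrict2 R \<gamma>') c d)"
    by (simp add: twist_cocycle_def RA_simps xy inv_RR_gamma conv_RR_def[of _ _ _ "conv_RR _ _ _ _ _"])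
  \<comment> \<open>The first factor is now \<open>left_twist\<close> with \<pi>, which is balanced
    but merely H-linear on the right, hence the lemma that retains the antipode factors.\<close>
  also have "\<dots> = DA sH x (\<lambda>a w. DA sH w (\<lambda>p q. DA sH y (\<lambda>b d. DA sH d (\<lambda>c e.
      ?V a (b \<cdot> \<sigma> (S (\<pi> c)) \<cdot> \<sigma> (S (\<pi> p))) \<bullet> W q e))))"
    by (rule sw_RR_balanced[OF xy, where \<Psi> = "\<lambda>a b c d. ?V a b \<bullet> W c d"])
      (simp_all add: L W inner after_coact_eq W_def[symmetric] left_twist_balanced[OF linear_maps(2)])
  also have "\<dots> = DA sH x (\<lambda>a w. DA sH y (\<lambda>b d. DA sH w (\<lambda>p q. DA sH d (\<lambda>c e.
      ?V a b \<bullet> S (\<pi> c) \<bullet> S (\<pi> p) \<bullet> W q e))))"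
    by (subst sw_swap[OF vs(2), of "comul A y"]) (simp only: left_twist_pi)
  also have "\<dots> = DA sH x (\<lambda>a w. DA sH y (\<lambda>b d. sH (\<gamma>' w d) (?V a b)))"
    by (simp only: cancel)
  also have "\<dots> = \<pi> (x \<star> y)"
    by (rule image_mulg[OF linear_maps(2), symmetric])
  finally show ?thesis .
qed

lemma twist_R_eq: "twist_R RA \<gamma>R = associated_R Ag H \<pi> \<sigma>"
proof -
  have "mul (twist_R RA \<gamma>R) = restrict2 R (\<lambda>x y. \<tau> (x \<star> y))"
  proof -
    \<comment> \<open>The twisted product is extensional, so agreement on R gives equality of
      functions.\<close>
    have "mul (twist_R RA \<gamma>R) = restrict2 R (mul (twist_R RA \<gamma>R))"
      by (simp add: twist_R_def RA_simps)
    also have "\<dots> = restrict2 R (\<lambda>x y. \<tau> (x \<star> y))"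
      by (rule restrict2_cong) (rule twist_mul_eq)
    finally show ?thesis .
  qed
  then show ?thesis
    by (simp add: twist_R_def associated_R_def Let_def twist_A_simps mulg_sigma)
qed

lemma twist_cocycle_associated:
  "twist_cocycle H RA \<gamma>R (associated_cocycle A H \<pi>) = associated_cocycle Ag H \<pi>"
proof -
  have "twist_cocycle H RA \<gamma>R (associated_cocycle A H \<pi>) =
      restrict2 R (twist_cocycle H RA \<gamma>R (associated_cocycle A H \<pi>))"
    by (simp add: twist_cocycle_def RA_simps)
  also have "\<dots> = restrict2 R (\<lambda>x y. \<pi> (x \<star> y))"
    by (rule restrict2_cong) (rule twist_cocycle_eq)
  finally show ?thesis by (simp add: associated_cocycle_def twist_A_simps)
qed

end

theorem corollary4p12:
  fixes H :: "('k::field_char_0, 'h::ab_group_add) hopf"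
    and A :: "('k, 'a::ab_group_add) bialg"
    and \<pi> :: "'a \<Rightarrow> 'h" and \<sigma> :: "'h \<Rightarrow> 'a"
    and R :: "('k, 'h, 'a) yd_prebialg" and \<xi> :: "'a \<Rightarrow> 'a \<Rightarrow> 'h"
    and \<gamma> \<gamma>\<^sub>R :: "'a \<Rightarrow> 'a \<Rightarrow> 'k"
  assumes "hopf_algebra H"
    and "splitting_datum A H \<pi> \<sigma>"
    and "(R, \<xi>) = associated_prebialgebra A H \<pi> \<sigma>"
    and "\<gamma> \<in> Z2 A H \<sigma>"
    and "\<gamma>\<^sub>R = restrict2 (car R) \<gamma>"
  shows "(\<exists>g. conv_inverse_RR R \<gamma>\<^sub>R g) \<and>
    (twist_R R \<gamma>\<^sub>R, twist_cocycle H R \<gamma>\<^sub>R \<xi>) = associated_prebialgebra (twist_A A \<gamma>) H \<pi> \<sigma>"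
proof -
  interpret splitting_cocycle H A \<pi> \<sigma> \<gamma>
    by unfold_locales (use assms in auto)
  have R: "R = RA" and \<xi>: "\<xi> = associated_cocycle A H \<pi>"
    using assms(3) by (simp_all add: associated_prebialgebra_def)
  have \<gamma>R: "\<gamma>\<^sub>R = restrict2 (coinvariants A H \<pi>) \<gamma>"
    using assms(5) by (simp add: R RA_simps)
  show ?thesis
    using conv_inverse_RR_gamma
    by (auto simp: R \<xi> \<gamma>R associated_prebialgebra_def twist_R_eq twist_cocycle_associated)
qed

end
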